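(* For every $d \ge 1$ there is a constant $C(d)$, depending only on $d$, such that for every $d\times d$ matrix weight $W$ on $\mathbb{R}$ satisfying the matrix $A_2$ condition and every $f \in L^2(W)$, $$\|S_W f\|_{L^2(\mathbb{R},\mathbb{R})}^2 = \sum_{I \in \mathcal{D}} \left\langle \langle W \rangle_I \widehat{f}(I), \widehat{f}(I) \right\rangle_{\mathbb{C}^d} \le C(d)\, [W]_{A_2}^2 \left(1+\log [W]_{A_2}\right) \|f\|_{L^2(W)}^2 .$$
   Context: A $d\times d$ matrix weight is a function $W$ on $\mathbb{R}$ with values in the complex $d\times d$ matrices, with locally integrable entries, such that $W(x)$ is positive semidefinite for a.e. $x$. $L^2(W)$ is the space of measurable $f:\mathbb{R}\to\mathbb{C}^d$ with $\|f\|_{L^2(W)}^2 = \int_{\mathbb{R}} \langle W(x)f(x),f(x)\rangle_{\mathbb{C}^d}\,dx<\infty$. For an interval $I$, $\langle W\rangle_I = \frac{1}{|I|}\int_I W(x)\,dx$. $W$ satisfies the matrix $A_2$ condition ($W \in A_2$) if $$[W]_{A_2} = \sup_I \left\| \langle W \rangle_I^{1/2}\langle W^{-1}\rangle_I^{1/2}\right\|^2<\infty,$$ the supremum being over all bounded intervals $I\subset\mathbb{R}$, where $\|\cdot\|$ is the operator norm on $\mathbb{C}^d$ (in particular $W$ is invertible a.e. and $W^{-1}$ is locally integrable). $\mathcal{D}$ is any fixed grid $\mathcal{D}^{\alpha,r}=\{\alpha+rI: I \text{ a standard dyadic interval}\}$ with $\alpha\in\mathbb{R}$, $r>0$ (for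 instance the standard dyadic grid); the constant does not depend on $\alpha, r$. For $I\in\mathcal{D}$ with left half $I_-$ and right half $I_+$, the Haar function is $h_I = |I|^{-1/2}(\mathbf{1}_{I_+}-\mathbf{1}_{I_-})$, and $\widehat{f}(I) = \int_I f(x)h_I(x)\,dx \in \mathbb{C}^d$. The generalized square function is $S_Wf(x)^2 = \mathbb{E}\big(\|W(x)^{1/2}T_\sigma f(x)\|_{\mathbb{C}^d}^2\big)$, where $T_\sigma f = \sum_{I\in\mathcal{D}}\sigma_I \widehat{f}(I)h_I$ and $\mathbb{E}$ is expectation over independent uniformly distributed random signs $\sigma_I\in\{-1,1\}$; its norm is $\|S_W f\|_{L^2(\mathbb{R},\mathbb{R})}^2=\sum_{I \in \mathcal{D}} \langle \langle W \rangle_I \widehat{f}(I), \widehat{f}(I) \rangle_{\mathbb{C}^d}$, and the theorem is to be understood as a statement about this sum. *)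

theory Defs
  imports "HOL-Analysis.Analysis"
begin

text \<open>
  The dimension \<open>d \<ge> 1\<close> is the cardinality of the finite index type \<open>'n\<close>: vectors of \<open>\<complex>\<^sup>d\<close>
  have type \<open>complex ^ 'n\<close> (whose norm is the Euclidean one), \<open>d \<times> d\<close> matrices have type
  \<open>complex ^ 'n ^ 'n\<close>. Measurability and integrals on \<open>\<real>\<close> refer to Lebesgue measure.
\<close>

definition cip :: "complex ^ 'n \<Rightarrow> complex ^ 'n \<Rightarrow> complex" where
  "cip u v = (\<Sum>i\<in>UNIV. u $ i * cnj (v $ i))"

definition adjoint_mat :: "complex ^ 'n ^ 'n \<Rightarrow> complex ^ 'n ^ 'n" where
  "adjoint_mat A = (\<chi> i j. cnj (A $ j $ i))"

definition pos_semidef :: "complex ^ 'n ^ 'n \<Rightarrow> bool" where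
  "pos_semidef A \<longleftrightarrow> adjoint_mat A = A \<and> (\<forall>v. 0 \<le> Re (cip (A *v v) v))"

text \<open>Only meaningful for positive semidefinite \<open>A\<close>, where the root exists and is unique.\<close>

definition mat_sqrt :: "complex ^ 'n ^ 'n \<Rightarrow> complex ^ 'n ^ 'n" where
  "mat_sqrt A = (THE B. pos_semidef B \<and> B ** B = A)"

definition op_norm :: "complex ^ 'n ^ 'n \<Rightarrow> real" where
  "op_norm A = onorm (\<lambda>v. A *v v)"

definition loc_integrable_entries :: "(real \<Rightarrow> complex ^ 'n ^ 'n) \<Rightarrow> bool" where
  "loc_integrable_entries W \<longleftrightarrow>
     (\<forall>i j a b. set_integrable lebesgue {a..b} (\<lambda>x. W x $ i $ j))"

definition matrix_weight :: "(real \<Rightarrow> complex ^ 'n ^ 'n) \<Rightarrow> bool" where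
  "matrix_weight W \<longleftrightarrow>
     loc_integrable_entries W \<and> (AE x in lebesgue. pos_semidef (W x))"

text \<open>
  A bounded nondegenerate interval is given by its endpoints \<open>a < b\<close>; including or excluding
  the endpoints affects none of the integrals below.
\<close>

definition avg :: "real \<Rightarrow> real \<Rightarrow> (real \<Rightarrow> complex ^ 'n ^ 'n) \<Rightarrow> complex ^ 'n ^ 'n" where
  "avg a b W = (1 / (b - a)) *\<^sub>R (LINT x:{a..b}|lebesgue. W x)"

definition A2_quantity :: "(real \<Rightarrow> complex ^ 'n ^ 'n) \<Rightarrow> real \<Rightarrow> real \<Rightarrow> real" where
  "A2_quantity W a b =
     (op_norm (mat_sqrt (avg a b W) ** mat_sqrt (avg a b (\<lambda>x. matrix_inv (W x)))))\<^sup>2"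

definition A2_const :: "(real \<Rightarrow> complex ^ 'n ^ 'n) \<Rightarrow> real" where
  "A2_const W = (SUP (a, b)\<in>{(a, b). a < b}. A2_quantity W a b)"

text \<open>
  Finiteness of the supremum presupposes that the averages of \<open>W\<^sup>-\<^sup>1\<close> exist; since integrals
  and \<open>matrix_inv\<close> are total here, this is an explicit part of the condition.
\<close>

definition matrix_A2 :: "(real \<Rightarrow> complex ^ 'n ^ 'n) \<Rightarrow> bool" where
  "matrix_A2 W \<longleftrightarrow>
     (AE x in lebesgue. invertible (W x)) \<and>
     loc_integrable_entries (\<lambda>x. matrix_inv (W x)) \<and>
     bdd_above ((\<lambda>(a, b). A2_quantity W a b) ` {(a, b). a < b})"

text \<open>The integrand is nonnegative a.e. for a matrix weight, so integrability is finiteness.\<close>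

definition L2_weighted :: "(real \<Rightarrow> complex ^ 'n ^ 'n) \<Rightarrow> (real \<Rightarrow> complex ^ 'n) set" where
  "L2_weighted W =
     {f. f \<in> borel_measurable lebesgue \<and>
         integrable lebesgue (\<lambda>x. Re (cip (W x *v f x) (f x)))}"

definition L2_weighted_normsq :: "(real \<Rightarrow> complex ^ 'n ^ 'n) \<Rightarrow> (real \<Rightarrow> complex ^ 'n) \<Rightarrow> real" where
  "L2_weighted_normsq W f = (LINT x|lebesgue. Re (cip (W x *v f x) (f x)))"

text \<open>
  The pair \<open>(a, b)\<close> stands for the interval \<open>[a, b)\<close>; the standard dyadic intervals are
  \<open>[k 2\<^sup>j, (k + 1) 2\<^sup>j)\<close> with integers \<open>j\<close> and \<open>k\<close>.
\<close>

definition standard_dyadic :: "(real \<times> real) set" where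
  "standard_dyadic =
     {(of_int k * 2 powi j, (of_int k + 1) * 2 powi j) | (k :: int) (j :: int). True}"

definition dyadic_grid :: "real \<Rightarrow> real \<Rightarrow> (real \<times> real) set" where
  "dyadic_grid \<alpha> r = (\<lambda>(a, b). (\<alpha> + r * a, \<alpha> + r * b)) ` standard_dyadic"

definition haar :: "real \<Rightarrow> real \<Rightarrow> real \<Rightarrow> real" where
  "haar a b x =
     (indicator {(a + b) / 2..<b} x - indicator {a..<(a + b) / 2} x) / sqrt (b - a)"

definition haar_coeff :: "(real \<Rightarrow> complex ^ 'n) \<Rightarrow> real \<Rightarrow> real \<Rightarrow> complex ^ 'n" where
  "haar_coeff f a b = (LINT x:{a..<b}|lebesgue. haar a b x *\<^sub>R f x)"

text \<open>
  The square of the norm of \<open>S\<^sub>W f\<close> is the sum of the following terms over the grid. Each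
  is real and nonnegative for a matrix weight, so \<open>Re\<close> discards nothing.
\<close>

definition square_function_term ::
    "(real \<Rightarrow> complex ^ 'n ^ 'n) \<Rightarrow> (real \<Rightarrow> complex ^ 'n) \<Rightarrow> real \<times> real \<Rightarrow> real" where
  "square_function_term W f = (\<lambda>(a, b).
     Re (cip (avg a b W *v haar_coeff f a b) (haar_coeff f a b)))"

definition square_function_normsq ::
    "(real \<times> real) set \<Rightarrow> (real \<Rightarrow> complex ^ 'n ^ 'n) \<Rightarrow> (real \<Rightarrow> complex ^ 'n) \<Rightarrow> real" where
  "square_function_normsq D W f = (\<Sum>\<^sub>\<infinity>I\<in>D. square_function_term W f I)"

end

theory Submission
  imports Defs
begin

text \<open>
  For a dyadic interval \<open>I\<close> put \<open>V = \<langle>W\<^sup>-\<^sup>1\<rangle>\<close>, \<open>x = \<langle>f\<rangle>\<close> and \<open>F = \<langle>(W f, f)\<rangle>\<close> (averages over \<open>I\<close>), let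
  \<open>Q = [W]\<close> be the \<open>A\<^sub>2\<close> constant, and let \<open>D\<close>, \<open>e\<close> be half the jumps of \<open>V\<close>, \<open>x\<close> between the halves
  of \<open>I\<close>. The term of \<open>I\<close> is \<open>|I| (\<langle>W\<rangle> e, e) \<le> Q |I| (V\<^sup>-\<^sup>1 e, e)\<close>. Splitting \<open>e = y + D V\<^sup>-\<^sup>1 x\<close>, the
  part \<open>y\<close> is paid for by the convexity of \<open>(V\<^sup>-\<^sup>1 x, x) \<le> F\<close>. The rest is at most
  \<open>\<mu> (V\<^sup>-\<^sup>1 x, x)\<close>, where \<open>\<mu>\<close> is controlled by the concavity defect of \<open>log det V\<close> on \<open>I\<close>; because
  \<open>log det V + log det \<langle>W\<rangle>\<close> lies between \<open>0\<close> and \<open>d log Q\<close>, these defects form a Carleson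
  sequence with constant of order \<open>1 + log Q\<close>. Using \<open>V \<le> Q \<langle>W\<rangle>\<^sup>-\<^sup>1\<close>, the corresponding Carleson embedding
  is proved by lowering the form to \<open>(Z\<^sup>-\<^sup>1 x, x)\<close> with \<open>V \<le> Z \<le> 2 V\<close>, where the mean of \<open>Z\<close> over the
  halves of \<open>I\<close> is below \<open>Z\<close> by a multiple of \<open>\<mu> V / (Q (1 + log Q))\<close>. Altogether the sum telescopes along an explicit
  Bellman function of \<open>V\<close>, \<open>\<langle>W\<rangle>\<close>, \<open>x\<close>, \<open>F\<close>.
\<close>

subsection \<open>Hermitian forms and simultaneous diagonalization\<close>

lemma Re_cip: "Re (cip u v) = u \<bullet> v"
  by (simp add: cip_def inner_vec_def inner_complex_def)

lemma cip_adjoint: "cip (A *v u) v = cip u (adjoint_mat A *v v)"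
proof -
  have "cip (A *v u) v = (\<Sum>i\<in>UNIV. \<Sum>j\<in>UNIV. A $ i $ j * u $ j * cnj (v $ i))"
    by (simp add: cip_def matrix_vector_mult_def sum_distrib_right)
  also have "\<dots> = (\<Sum>j\<in>UNIV. \<Sum>i\<in>UNIV. A $ i $ j * u $ j * cnj (v $ i))"
    by (rule sum.swap)
  also have "\<dots> = cip u (adjoint_mat A *v v)"
    by (simp add: cip_def matrix_vector_mult_def adjoint_mat_def sum_distrib_left mult_ac)
  finally show ?thesis .
qed

lemma inner_adjoint: "(A *v u) \<bullet> v = u \<bullet> (adjoint_mat A *v v)"
  by (metis Re_cip cip_adjoint)

lemma cip_add_left: "cip (u + v) w = cip u w + cip v w"
  by (simp add: cip_def sum.distrib distrib_right)

lemma cip_cmult_left: "cip (c *s u) w = c * cip u w"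
  by (simp add: cip_def sum_distrib_left mult.assoc)

lemma cip_diff_left: "cip (u - v) w = cip u w - cip v w"
  by (simp add: cip_def sum_subtractf left_diff_distrib)

lemma cip_commute: "cip v u = cnj (cip u v)"
  by (simp add: cip_def mult.commute)

lemma cip_zero_left [simp]: "cip 0 w = 0"
  by (simp add: cip_def)

lemma cip_sum_left: "cip (\<Sum>i\<in>S. g i) w = (\<Sum>i\<in>S. cip (g i) w)"
  by (induction S rule: infinite_finite_induct) (simp_all add: cip_add_left)

text \<open>The real inner product is only the real part of \<open>cip\<close>; testing with the
  multiples 1 and i of \<open>u\<close> recovers both parts.\<close>

lemma cip_eq_zero_iff_Re: "cip u v = 0 \<longleftrightarrow> (\<forall>c. (c *s u) \<bullet> v = 0)"
proof
  assume "cip u v = 0" then show "\<forall>c. (c *s u) \<bullet> v = 0"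
    by (metis Re_cip cip_cmult_left mult_zero_right zero_complex.sel(1))
next
  assume "\<forall>c. (c *s u) \<bullet> v = 0"
  then have "Re (c * cip u v) = 0" for c
    by (metis Re_cip cip_cmult_left)
  from this[of 1] this[of \<i>] show "cip u v = 0"
    by (simp add: complex_eq_iff)
qed

lemma adjoint_adjoint [simp]: "adjoint_mat (adjoint_mat A) = A"
  by (simp add: adjoint_mat_def vec_eq_iff)

lemma adjoint_mult: "adjoint_mat (A ** B) = adjoint_mat B ** adjoint_mat A"
  by (simp add: adjoint_mat_def matrix_matrix_mult_def vec_eq_iff mult.commute)

lemma adjoint_add: "adjoint_mat (A + B) = adjoint_mat A + adjoint_mat B"
  by (simp add: adjoint_mat_def vec_eq_iff)

lemma adjoint_diff: "adjoint_mat (A - B) = adjoint_mat A - adjoint_mat B"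
  by (simp add: adjoint_mat_def vec_eq_iff)

lemma adjoint_scaleR: "adjoint_mat (c *\<^sub>R A) = c *\<^sub>R adjoint_mat A"
  by (simp add: adjoint_mat_def vec_eq_iff)

lemma adjoint_one [simp]: "adjoint_mat (mat 1) = mat 1"
  by (auto simp: adjoint_mat_def vec_eq_iff mat_def)

lemma det_adjoint: "det (adjoint_mat A) = cnj (det A)"
proof -
  have "adjoint_mat A = transpose (\<chi> i j. cnj (A $ i $ j))"
    by (simp add: adjoint_mat_def transpose_def vec_eq_iff)
  then have "det (adjoint_mat A) = det (\<chi> i j. cnj (A $ i $ j))"
    by simp
  also have "\<dots> = cnj (det A)"
    by (simp add: det_def)
  finally show ?thesis .
qed

definition pos_def :: "complex ^ 'n ^ 'n \<Rightarrow> bool" where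
  "pos_def A \<longleftrightarrow> adjoint_mat A = A \<and> (\<forall>v. v \<noteq> 0 \<longrightarrow> 0 < (A *v v) \<bullet> v)"

lemma pos_defD: "pos_def A \<Longrightarrow> v \<noteq> 0 \<Longrightarrow> 0 < (A *v v) \<bullet> v"
  and pos_def_adjoint: "pos_def A \<Longrightarrow> adjoint_mat A = A"
  by (auto simp: pos_def_def)

lemma pos_def_nonneg: "pos_def A \<Longrightarrow> 0 \<le> (A *v v) \<bullet> v"
  by (cases "v = 0") (auto simp: pos_def_def intro: less_imp_le)

lemma pos_semidef_iff: "pos_semidef A \<longleftrightarrow> adjoint_mat A = A \<and> (\<forall>v. 0 \<le> (A *v v) \<bullet> v)"
  by (simp add: pos_semidef_def Re_cip)

lemma herm_inner: "adjoint_mat A = A \<Longrightarrow> (A *v u) \<bullet> v = u \<bullet> (A *v v)"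
  by (metis inner_adjoint)

lemma herm_cip: "adjoint_mat A = A \<Longrightarrow> cip (A *v u) v = cip u (A *v v)"
  by (metis cip_adjoint)

lemma herm_quadratic_add:
  assumes "adjoint_mat A = A"
  shows "(A *v (u + v)) \<bullet> (u + v) = (A *v u) \<bullet> u + 2 * ((A *v u) \<bullet> v) + (A *v v) \<bullet> v"
  using herm_inner[OF assms, of v u]
  by (simp add: matrix_vector_right_distrib inner_add_left inner_add_right inner_commute)

lemma herm_quadratic_diff:
  assumes "adjoint_mat A = A"
  shows "(A *v (u - v)) \<bullet> (u - v) = (A *v u) \<bullet> u - 2 * ((A *v u) \<bullet> v) + (A *v v) \<bullet> v"
  using herm_inner[OF assms, of v u]
  by (simp add: matrix_vector_mult_diff_distrib inner_diff_left inner_diff_right inner_commute)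

lemma matrix_scaleR_vector: "(c *\<^sub>R A) *v u = c *\<^sub>R (A *v u)" for A :: "complex ^ 'n ^ 'm"
  by (simp add: vec_eq_iff matrix_vector_mult_def scaleR_sum_right)

lemma matrix_vector_scaleR: "A *v (c *\<^sub>R u) = c *\<^sub>R (A *v u)" for A :: "complex ^ 'n ^ 'm"
  by (simp add: vec_eq_iff matrix_vector_mult_def scaleR_sum_right)

lemma quadratic_scaleR: "(A *v (c *\<^sub>R u)) \<bullet> (c *\<^sub>R u) = c\<^sup>2 * ((A *v u) \<bullet> u)"
  for A :: "complex ^ 'n ^ 'n"
  by (simp add: matrix_vector_scaleR power2_eq_square)

text \<open>First-order condition at a minimum: the polynomial in \<open>t\<close> vanishes at 0, so
  its derivative \<open>2 * b\<close> there must be zero.\<close>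

lemma nonneg_linear_term_zero:
  fixes b c :: real
  assumes "\<And>t. 0 \<le> 2 * t * b + t\<^sup>2 * c"
  shows "b = 0"
proof (rule ccontr)
  assume b: "b \<noteq> 0"
  \<comment> \<open>The point \<open>t = - b / d\<close> will give a negative value; adding 1 keeps
    the denominator positive and above \<open>c\<close> whatever the sign of
    \<open>c\<close>.\<close>
  define d where "d = \<bar>c\<bar> + 1"
  have d: "d > 0" "c < d" unfolding d_def by auto
  have "0 \<le> 2 * (- b / d) * b + (- b / d)\<^sup>2 * c" by (rule assms)
  also have "\<dots> \<le> 2 * (- b / d) * b + (- b / d)\<^sup>2 * d"
    using d by (intro add_left_mono mult_left_mono) auto
  also have "\<dots> = - b\<^sup>2 / d" using d by (simp add: power2_eq_square field_simps)
  also have "\<dots> < 0" using b d by simp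
  finally show False by simp
qed

text \<open>The conditions for the indices in \<open>S\<close> form a square linear system whose row
  \<open>k\<close> is zero, so its matrix is singular and has a nontrivial kernel.\<close>

lemma orthogonal_vector_exists:
  fixes a :: "'n \<Rightarrow> complex ^ 'n"
  assumes "k \<notin> S"
  obtains w where "w \<noteq> 0" "\<And>i. i \<in> S \<Longrightarrow> cip w (a i) = 0"
proof -
  define M :: "complex ^ 'n ^ 'n" where "M = (\<chi> i j. if i \<in> S then cnj (a i $ j) else 0)"
  have "\<nexists>B. B ** M = mat 1"
  proof
    assume "\<exists>B. B ** M = mat 1"
    then obtain B where "M ** B = mat 1" using matrix_left_right_inverse by blast
    then have "(M ** B) $ k $ k = 1" by (simp add: mat_def)
    moreover have "(M ** B) $ k $ k = 0" using assms by (simp add: matrix_matrix_mult_def M_def)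
    ultimately show False by simp
  qed
  then obtain w where w: "w \<noteq> 0" "M *v w = 0" using matrix_left_invertible_ker by blast
  have "cip w (a i) = 0" if "i \<in> S" for i
  proof -
    have "cip w (a i) = (M *v w) $ i"
      using that by (simp add: cip_def matrix_vector_mult_def M_def mult.commute)
    then show ?thesis using w by simp
  qed
  with w that show ?thesis by blast
qed

text \<open>
  The next eigenvector maximizes the Rayleigh quotient of \<open>D\<close> with respect to \<open>A\<close> over the
  \<open>A\<close>-orthogonal complement of the previous ones.
\<close>

lemma pencil_eigenvectors:
  fixes A D :: "complex ^ 'n ^ 'n" and S :: "'n set"
  assumes A: "pos_def A" and D: "adjoint_mat D = D"
  shows "\<exists>v l. (\<forall>i\<in>S. \<forall>j\<in>S. cip (A *v v i) (v j) = (if i = j then 1 else 0))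
             \<and> (\<forall>i\<in>S. D *v v i = (l i :: real) *\<^sub>R (A *v v i))" (is "\<exists>v l. ?P S v l")
proof -
  have "finite S" by simp
  then show ?thesis
  proof (induction S rule: finite_induct)
    case empty
    show ?case by simp
  next
    case (insert k S)
    then obtain v l where vl: "?P S v l" by blast
    note A' = pos_def_adjoint[OF A]
    define K where "K = {u. norm u = 1 \<and> (\<forall>i\<in>S. cip u (A *v v i) = 0)}"
    have "K = sphere 0 1 \<inter> (\<Inter>i\<in>S. {u. cip u (A *v v i) = 0})"
      by (auto simp: K_def)
    moreover have "closed {u. cip u (A *v v i) = 0}" for i
      unfolding cip_def by (intro closed_Collect_eq continuous_intros)
    ultimately have "compact K" by (auto intro!: compact_Int_closed closed_INT)
    obtain w where w: "w \<noteq> 0" "\<And>i. i \<in> S \<Longrightarrow> cip w (A *v v i) = 0"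
      using orthogonal_vector_exists[OF insert.hyps(2), of "\<lambda>i. A *v v i"] by blast
    have scale: "cip (c *\<^sub>R u) z = of_real c * cip u z" for c u and z :: "complex ^ 'n"
      by (simp add: cip_def sum_distrib_left scaleR_conv_of_real[where 'a=complex] mult.assoc)
    have inK: "(1 / norm u) *\<^sub>R u \<in> K" if "u \<noteq> 0" "\<forall>i\<in>S. cip u (A *v v i) = 0" for u
      using that by (auto simp: K_def scale)
    have "K \<noteq> {}" using inK[of w] w by blast
    define q where "q u = ((D *v u) \<bullet> u) / ((A *v u) \<bullet> u)" for u
    have Apos: "u \<noteq> 0 \<Longrightarrow> (A *v u) \<bullet> u > 0" for u by (rule pos_defD[OF A])
    have "continuous_on K q"
      unfolding q_def
    proof (intro continuous_intros linear_continuous_on_compose[where f="\<lambda>u. u"] ballI)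
      fix u assume "u \<in> K"
      then have "u \<noteq> 0" by (auto simp: K_def)
      then show "(A *v u) \<bullet> u \<noteq> 0" using Apos[of u] by simp
    qed
    then obtain u where u: "u \<in> K" "\<And>w. w \<in> K \<Longrightarrow> q w \<le> q u"
      using continuous_attains_sup[OF \<open>compact K\<close> \<open>K \<noteq> {}\<close>] by blast
    have u0: "u \<noteq> 0" using u(1) by (auto simp: K_def)
    \<comment> \<open>The form of \<open>E\<close> is nonnegative on the complement of the earlier
      eigenvectors and vanishes at the maximizer \<open>u\<close>. So \<open>u\<close> minimizes it
      there, and the first variation is zero.\<close>
    define E where "E = q u *\<^sub>R A - D"
    have E': "adjoint_mat E = E" by (simp add: E_def adjoint_diff adjoint_scaleR A' D)
    have Ev: "E *v z = q u *\<^sub>R (A *v z) - D *v z" for z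
      by (simp add: E_def matrix_vector_mult_diff_rdistrib matrix_scaleR_vector)
    have Eu: "(E *v u) \<bullet> u = 0"
      using Apos[OF u0] by (simp add: Ev inner_diff_left q_def)
    have Enn: "0 \<le> (E *v z) \<bullet> z" if z: "\<forall>i\<in>S. cip z (A *v v i) = 0" for z
    proof (cases "z = 0")
      case False
      have "q ((1 / norm z) *\<^sub>R z) \<le> q u" by (rule u(2)[OF inK[OF False z]])
      moreover have "q ((1 / norm z) *\<^sub>R z) = q z"
        unfolding q_def quadratic_scaleR using False by simp
      ultimately have "q z \<le> q u" by simp
      then have "(D *v z) \<bullet> z \<le> q u * ((A *v z) \<bullet> z)"
        using Apos[OF False] unfolding q_def[of z] by (simp add: pos_divide_le_eq)
      then show ?thesis by (simp add: Ev inner_diff_left)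
    qed simp
    have uS: "\<forall>i\<in>S. cip u (A *v v i) = 0" using u(1) by (simp add: K_def)
    have orth: "(E *v u) \<bullet> z = 0" if z: "\<forall>i\<in>S. cip z (A *v v i) = 0" for z
    proof (rule nonneg_linear_term_zero)
      fix t :: real
      have "0 \<le> (E *v (u + t *\<^sub>R z)) \<bullet> (u + t *\<^sub>R z)"
        by (rule Enn) (simp add: cip_add_left scale uS z)
      then show "0 \<le> 2 * t * ((E *v u) \<bullet> z) + t\<^sup>2 * ((E *v z) \<bullet> z)"
        unfolding herm_quadratic_add[OF E'] quadratic_scaleR by (simp add: Eu mult.assoc)
    qed
    have ESv: "cip (E *v u) (v i) = 0" if "i \<in> S" for i
    proof -
      have "E *v v i = (q u - l i) *\<^sub>R (A *v v i)"
        using vl that by (simp add: Ev scaleR_left_diff_distrib)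
      then have "cip u (E *v v i) = of_real (q u - l i) * cip u (A *v v i)"
        by (metis cip_commute scale complex_cnj_mult complex_cnj_complex_of_real)
      then show ?thesis using uS that by (simp add: herm_cip[OF E'])
    qed
    have Eu0: "E *v u = 0"
    proof -
      let ?z = "E *v u"
      \<comment> \<open>Subtracting the \<open>A\<close>-projection of \<open>E u\<close> onto the
        earlier eigenvectors leaves a vector \<open>z\<close> of the complement. Now
        \<open>E u\<close> is orthogonal to \<open>z\<close> by minimality and to every
        \<open>v i\<close> by the eigenvector equations, hence to itself.\<close>
      define z where "z = ?z - (\<Sum>i\<in>S. cip ?z (A *v v i) *s v i)"
      have zS: "cip z (A *v v j) = 0" if "j \<in> S" for j
      proof -
        have "cip (v i) (A *v v j) = (if i = j then 1 else 0)" if "i \<in> S" for i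
          using vl that \<open>j \<in> S\<close> herm_cip[OF A', of "v i" "v j"] by simp
        then have "(\<Sum>i\<in>S. cip ?z (A *v v i) * cip (v i) (A *v v j)) = 
            (\<Sum>i\<in>S. if i = j then cip ?z (A *v v j) else 0)"
          by (intro sum.cong) auto
        then show ?thesis
          using that by (simp add: z_def cip_diff_left cip_sum_left cip_cmult_left)
      qed
      have "?z = z + (\<Sum>i\<in>S. cip ?z (A *v v i) *s v i)" by (simp add: z_def)
      then have "?z \<bullet> ?z = ?z \<bullet> z + ?z \<bullet> (\<Sum>i\<in>S. cip ?z (A *v v i) *s v i)"
        by (metis inner_add_right)
      also have "?z \<bullet> z = 0" using orth zS by blast
      also have "?z \<bullet> (\<Sum>i\<in>S. cip ?z (A *v v i) *s v i) = 0"
        unfolding inner_sum_right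
      proof (rule sum.neutral, rule)
        fix i assume "i \<in> S"
        then have "cip (v i) ?z = 0" using ESv by (metis cip_commute complex_cnj_zero)
        then show "?z \<bullet> (cip ?z (A *v v i) *s v i) = 0"
          unfolding cip_eq_zero_iff_Re by (metis inner_commute)
      qed
      finally show ?thesis by simp
    qed
    define c where "c = 1 / sqrt ((A *v u) \<bullet> u)"
    define v' where "v' = v(k := c *\<^sub>R u)"
    define l' where "l' = l(k := q u)"
    have Auu: "cip (A *v u) u = of_real ((A *v u) \<bullet> u)"
      by (metis Re_cip herm_cip[OF A'] cip_commute Reals_cnj_iff complex_is_Real_iff
            of_real_Re)
    have cu: "cip (A *v (c *\<^sub>R u)) (c *\<^sub>R u) = 1"
    proof -
      have "cip (A *v (c *\<^sub>R u)) (c *\<^sub>R u) = of_real (c * c) * cip (A *v u) u"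
        unfolding matrix_vector_scaleR scale
        by (metis (no_types, lifting) cip_commute scale complex_cnj_mult complex_cnj_complex_of_real 
            mult.assoc of_real_mult)
      also have "\<dots> = 1" using Apos[OF u0] by (simp add: Auu c_def flip: of_real_mult)
      finally show ?thesis .
    qed
    have cS: "cip (A *v (c *\<^sub>R u)) (v i) = 0" "cip (A *v v i) (c *\<^sub>R u) = 0" if "i \<in> S" for i
    proof -
      show "cip (A *v (c *\<^sub>R u)) (v i) = 0"
        using that uS by (simp add: herm_cip[OF A'] scale)
      then show "cip (A *v v i) (c *\<^sub>R u) = 0"
        by (metis herm_cip[OF A'] cip_commute complex_cnj_zero)
    qed
    have "D *v (c *\<^sub>R u) = q u *\<^sub>R (A *v (c *\<^sub>R u))"
    proof -
      have "D *v u = q u *\<^sub>R (A *v u)" using Eu0 by (simp add: Ev)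
      then show ?thesis by (simp add: matrix_vector_scaleR mult.commute)
    qed
    then have "?P (insert k S) v' l'"
      using vl cu cS insert.hyps(2) by (auto simp: v'_def l'_def)
    then show ?case by blast
  qed
qed

section \<open>Diagonal matrices and square roots of positive semidefinite matrices\<close>

lemma matrix_inv_eqI:
  fixes A B :: "'a::field ^ 'n ^ 'n"
  assumes "A ** B = mat 1"
  shows "matrix_inv A = B"
proof -
  have BA: "B ** A = mat 1" using assms by (simp add: matrix_left_right_inverse)
  have "\<exists>A'. A ** A' = mat 1 \<and> A' ** A = mat 1" using assms BA by blast
  then have "matrix_inv A ** A = mat 1" unfolding matrix_inv_def by (rule someI2_ex) simp
  then show ?thesis by (metis assms matrix_mul_assoc matrix_mul_lid matrix_mul_rid)
qed

definition diag :: "('n \<Rightarrow> real) \<Rightarrow> complex ^ 'n ^ 'n" where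
  "diag l = (\<chi> i j. if i = j then of_real (l i) else 0)"

lemma diag_mult_vector: "(diag l *v z) $ i = l i *\<^sub>R z $ i"
proof -
  have "(\<Sum>j\<in>UNIV. (if i = j then complex_of_real (l i) else 0) * z $ j)
      = (\<Sum>j\<in>UNIV. if i = j then complex_of_real (l i) * z $ j else 0)"
    by (intro sum.cong) auto
  then show ?thesis by (simp add: diag_def matrix_vector_mult_def scaleR_conv_of_real)
qed

lemma diag_quadratic: "(diag l *v z) \<bullet> z = (\<Sum>i\<in>UNIV. l i * (norm (z $ i))\<^sup>2)"
  by (simp add: inner_vec_def diag_mult_vector power2_norm_eq_inner)

lemma diag_quadratic_axis: "(diag l *v axis i 1) \<bullet> axis i 1 = l i"
  by (simp add: inner_axis diag_mult_vector)

lemma diag_mult: "diag l ** diag m = diag (\<lambda>i. l i * m i)"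
  by (simp add: matrix_eq flip: matrix_vector_mul_assoc) (simp add: vec_eq_iff diag_mult_vector)

lemma diag_one: "diag (\<lambda>i. 1) = mat 1"
  by (simp add: diag_def mat_def vec_eq_iff)

lemma diag_add: "diag l + diag m = diag (\<lambda>i. l i + m i)"
  by (simp add: diag_def vec_eq_iff)

lemma diag_diff: "diag l - diag m = diag (\<lambda>i. l i - m i)"
  by (simp add: diag_def vec_eq_iff)

lemma adjoint_diag [simp]: "adjoint_mat (diag l) = diag l"
  by (auto simp: diag_def adjoint_mat_def vec_eq_iff)

lemma det_diag: "det (diag l) = of_real (\<Prod>i\<in>UNIV. l i)"
  by (subst det_diagonal) (simp_all add: diag_def)

lemma norm_sq_vec: "(norm (z :: complex ^ 'n))\<^sup>2 = (\<Sum>i\<in>UNIV. (norm (z $ i))\<^sup>2)"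
  by (simp add: norm_vec_def L2_set_def sum_nonneg)

text \<open>The columns of \<open>T\<close> are the \<open>A\<close>-orthonormal eigenvectors for
  the full index set; the third equation is the eigenvector equation read column by column.\<close>

lemma pencil_diagonalization:
  fixes A D :: "complex ^ 'n ^ 'n"
  assumes A: "pos_def A" and D: "adjoint_mat D = D"
  obtains T l where "adjoint_mat T ** A ** T = mat 1" "adjoint_mat T ** D ** T = diag l"
    "D ** T = A ** T ** diag l"
proof -
  obtain v and l :: "'n \<Rightarrow> real"
    where "\<forall>i\<in>UNIV. \<forall>j\<in>UNIV. cip (A *v v i) (v j) = (if i = j then 1 else 0)"
      and "\<forall>i\<in>UNIV. D *v v i = l i *\<^sub>R (A *v v i)"
    using pencil_eigenvectors[OF A D, of UNIV] by blast
  then have v: "\<And>i j. cip (A *v v i) (v j) = (if i = j then 1 else 0)"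
    and l: "\<And>i. D *v v i = l i *\<^sub>R (A *v v i)"
    by auto
  define T where "T = (\<chi> r i. v i $ r)"
  have col: "(X ** T) $ r $ i = (X *v v i) $ r" for X :: "complex ^ 'n ^ 'n" and r i
    by (simp add: matrix_matrix_mult_def matrix_vector_mult_def T_def)
  have entry: "(adjoint_mat T ** X) $ j $ i = cip (\<chi> r. X $ r $ i) (v j)" for X i j
    by (simp add: matrix_matrix_mult_def adjoint_mat_def T_def cip_def mult.commute)
  have colA: "(\<chi> r. (A ** T) $ r $ i) = A *v v i" for i
    by (simp add: vec_eq_iff col)
  have "(adjoint_mat T ** (A ** T)) $ j $ i = (mat 1 :: complex ^ 'n ^ 'n) $ j $ i" for i j
    unfolding entry colA v by (auto simp: mat_def)
  then have 1: "adjoint_mat T ** (A ** T) = mat 1" by (simp add: vec_eq_iff)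
  have diagcol: "(X ** diag l) $ r $ i = l i *\<^sub>R (X $ r $ i)" for X :: "complex ^ 'n ^ 'n" and r i
  proof -
    have "(\<Sum>k\<in>UNIV. X $ r $ k * (if k = i then complex_of_real (l k) else 0))
        = (\<Sum>k\<in>UNIV. if k = i then complex_of_real (l i) * X $ r $ i else 0)"
      by (intro sum.cong) auto
    then show ?thesis by (simp add: matrix_matrix_mult_def diag_def scaleR_conv_of_real)
  qed
  have 2: "D ** T = A ** T ** diag l"
    by (simp add: vec_eq_iff diagcol col l)
  have "adjoint_mat T ** D ** T = adjoint_mat T ** (A ** T ** diag l)"
    by (metis 2 matrix_mul_assoc)
  also have "\<dots> = diag l" by (metis 1 matrix_mul_assoc matrix_mul_lid)
  finally have 3: "adjoint_mat T ** D ** T = diag l" .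
  show ?thesis using that 1 2 3 by (metis matrix_mul_assoc)
qed

lemma pos_def_mat_1: "pos_def (mat 1 :: complex ^ 'n ^ 'n)"
  by (simp add: pos_def_def)

lemma congruence_quadratic: "((adjoint_mat T ** X ** T) *v z) \<bullet> z = (X *v (T *v z)) \<bullet> (T *v z)"
proof -
  have "((adjoint_mat T ** X ** T) *v z) \<bullet> z = (adjoint_mat T *v (X *v (T *v z))) \<bullet> z"
    by (simp add: matrix_vector_mul_assoc matrix_mul_assoc)
  also have "\<dots> = (X *v (T *v z)) \<bullet> (adjoint_mat (adjoint_mat T) *v z)"
    by (rule inner_adjoint)
  finally show ?thesis by simp
qed

lemma congruence_det: "det (adjoint_mat T ** X ** T) = of_real ((cmod (det T))\<^sup>2) * det X"
  unfolding complex_norm_square by (simp add: det_mul det_adjoint)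

text \<open>The pencil of \<open>A\<close> with the identity is the spectral theorem:
  \<open>T\<close> is unitary, and the square roots of the eigenvalues are transported back by
  it.\<close>

lemma pos_semidef_sqrt_exists:
  fixes A :: "complex ^ 'n ^ 'n"
  assumes "pos_semidef A"
  shows "\<exists>B. pos_semidef B \<and> B ** B = A"
proof -
  have A: "adjoint_mat A = A" "\<And>v. 0 \<le> (A *v v) \<bullet> v"
    using assms by (auto simp: pos_semidef_iff)
  obtain T l where T: "adjoint_mat T ** mat 1 ** T = mat 1" "adjoint_mat T ** A ** T = diag l"
      "A ** T = mat 1 ** T ** diag l"
    by (rule pencil_diagonalization[OF pos_def_mat_1 A(1)])
  have TT: "T ** adjoint_mat T = mat 1" "adjoint_mat T ** T = mat 1"
    using T(1) by (simp_all add: matrix_left_right_inverse)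
  have l: "l i \<ge> 0" for i
  proof -
    have "0 \<le> (diag l *v axis i 1) \<bullet> axis i 1"
      unfolding T(2)[symmetric] congruence_quadratic by (rule A(2))
    then show ?thesis
      by (simp add: diag_quadratic_axis)
  qed
  define R where "R = diag (\<lambda>i. sqrt (l i))"
  define B where "B = T ** R ** adjoint_mat T"
  have RR: "R ** R = diag l" using l by (simp add: R_def diag_mult)
  have "B ** B = T ** R ** (adjoint_mat T ** T) ** R ** adjoint_mat T"
    by (simp add: B_def matrix_mul_assoc)
  also have "\<dots> = T ** (R ** R) ** adjoint_mat T"
    by (simp add: TT matrix_mul_assoc)
  also have "\<dots> = A ** T ** adjoint_mat T" by (simp add: RR T(3))
  also have "\<dots> = A ** (T ** adjoint_mat T)" by (simp add: matrix_mul_assoc)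
  finally have BB: "B ** B = A" by (simp add: TT)
  have "adjoint_mat B = B"
    by (simp add: B_def adjoint_mult R_def matrix_mul_assoc)
  moreover have "0 \<le> (B *v v) \<bullet> v" for v
  proof -
    have "B = adjoint_mat (adjoint_mat T) ** R ** adjoint_mat T" by (simp add: B_def)
    then have "(B *v v) \<bullet> v = (R *v (adjoint_mat T *v v)) \<bullet> (adjoint_mat T *v v)"
      by (metis congruence_quadratic)
    then show ?thesis by (simp add: R_def diag_quadratic sum_nonneg l)
  qed
  ultimately show ?thesis using BB by (auto simp: pos_semidef_iff)
qed

text \<open>For an eigenvector v of \<open>B\<close> with eigenvalue b, (C + b)(C - b)v = 0. If b >
  0, then C + b is injective; if b = 0, then the norm of C v vanishes. So \<open>C\<close> agrees
  with \<open>B\<close> on an eigenbasis.\<close>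

lemma pos_semidef_sqrt_unique:
  fixes B C :: "complex ^ 'n ^ 'n"
  assumes B: "pos_semidef B" and C: "pos_semidef C" and eq: "B ** B = C ** C"
  shows "C = B"
proof -
  have B': "adjoint_mat B = B" "\<And>v. 0 \<le> (B *v v) \<bullet> v"
    using B by (auto simp: pos_semidef_iff)
  have C': "adjoint_mat C = C" "\<And>v. 0 \<le> (C *v v) \<bullet> v"
    using C by (auto simp: pos_semidef_iff)
  obtain T b where T: "adjoint_mat T ** mat 1 ** T = mat 1" "adjoint_mat T ** B ** T = diag b"
      "B ** T = mat 1 ** T ** diag b"
    by (rule pencil_diagonalization[OF pos_def_mat_1 B'(1)])
  have TT: "T ** adjoint_mat T = mat 1" "adjoint_mat T ** T = mat 1"
    using T(1) by (simp_all add: matrix_left_right_inverse)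
  have b: "b i \<ge> 0" for i
  proof -
    have "0 \<le> (diag b *v axis i 1) \<bullet> axis i 1"
      unfolding T(2)[symmetric] congruence_quadratic by (rule B'(2))
    then show ?thesis
      by (simp add: diag_quadratic_axis)
  qed
  have "C *v (T *v axis i 1) = B *v (T *v axis i 1)" for i
  proof -
    define v where "v = T *v axis i 1"
    have dax: "diag b *v axis i 1 = b i *\<^sub>R axis i 1"
      by (auto simp: vec_eq_iff diag_mult_vector axis_def)
    have Bv: "B *v v = b i *\<^sub>R v"
    proof -
      have "B *v v = (B ** T) *v axis i 1" by (simp add: v_def matrix_vector_mul_assoc)
      also have "\<dots> = T *v (diag b *v axis i 1)" by (simp add: T(3) matrix_vector_mul_assoc)
      finally show ?thesis by (simp add: dax matrix_vector_scaleR v_def)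
    qed
    have "C *v (C *v v) = B *v (B *v v)" by (simp add: matrix_vector_mul_assoc eq)
    then have CC: "C *v (C *v v) = (b i)\<^sup>2 *\<^sub>R v"
      by (simp add: Bv matrix_vector_scaleR power2_eq_square)
    have "C *v v = b i *\<^sub>R v"
    proof (cases "b i = 0")
      case True
      have "(C *v v) \<bullet> (C *v v) = (C *v (C *v v)) \<bullet> v"
        by (simp add: herm_inner[OF C'(1)])
      then show ?thesis using True CC by simp
    next
      case False
      define y where "y = C *v v - b i *\<^sub>R v"
      have "C *v y = - (b i *\<^sub>R y)"
        by (simp add: y_def matrix_vector_mult_diff_distrib CC matrix_vector_scaleR
            scaleR_right_diff_distrib power2_eq_square)
      then have "0 \<le> - (b i * (y \<bullet> y))" using C'(2)[of y] by simp
      then have "y \<bullet> y \<le> 0" using b[of i] False by (simp add: mult_le_0_iff)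
      then have "y = 0" by (metis inner_gt_zero_iff not_less)
      then show ?thesis by (simp add: y_def)
    qed
    then show ?thesis using Bv by (simp add: v_def)
  qed
  then have "(C ** T) *v axis i 1 = (B ** T) *v axis i 1" for i
    by (simp add: matrix_vector_mul_assoc)
  moreover have "(X *v axis i 1) $ r = X $ r $ i" for X :: "complex ^ 'n ^ 'n" and i r
    by (simp add: matrix_vector_mult_def axis_def if_distrib cong: if_cong)
  ultimately have "(C ** T) $ r $ i = (B ** T) $ r $ i" for r i
    by metis
  then have "C ** T = B ** T" by (simp add: vec_eq_iff)
  then have "C ** (T ** adjoint_mat T) = B ** (T ** adjoint_mat T)" by (metis matrix_mul_assoc)
  then show ?thesis by (simp add: TT)
qed

lemma mat_sqrt:
  assumes "pos_semidef A"
  shows "pos_semidef (mat_sqrt A)" "mat_sqrt A ** mat_sqrt A = A"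
proof -
  have "\<exists>!B. pos_semidef B \<and> B ** B = A"
    using pos_semidef_sqrt_exists[OF assms] pos_semidef_sqrt_unique by metis
  from theI'[OF this] show "pos_semidef (mat_sqrt A)" "mat_sqrt A ** mat_sqrt A = A"
    by (simp_all add: mat_sqrt_def)
qed

subsection \<open>Inverses and determinants of positive definite matrices\<close>

text \<open>Inverting T^* A T = 1 expresses the inverse of \<open>A\<close> through the same
  \<open>T\<close> that diagonalizes \<open>D\<close>.\<close>

lemma pos_def_diagonalization:
  fixes A D :: "complex ^ 'n ^ 'n"
  assumes A: "pos_def A" and D: "adjoint_mat D = D"
  obtains T l where "adjoint_mat T ** A ** T = mat 1" "adjoint_mat T ** D ** T = diag l"
    "D ** T = A ** T ** diag l" "matrix_inv A = T ** adjoint_mat T" "invertible T"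
    "det T \<noteq> 0"
proof -
  obtain T l where T: "adjoint_mat T ** A ** T = mat 1" "adjoint_mat T ** D ** T = diag l"
    "D ** T = A ** T ** diag l"
    using pencil_diagonalization[OF A D] by blast
  then have inv: "invertible T" by (auto simp: invertible_left_inverse)
  have "adjoint_mat T ** (A ** T) = mat 1" by (metis T(1) matrix_mul_assoc)
  then have "A ** T ** adjoint_mat T = mat 1" by (simp add: matrix_left_right_inverse)
  then have "matrix_inv A = T ** adjoint_mat T" by (metis matrix_inv_eqI matrix_mul_assoc)
  moreover have "det T \<noteq> 0" using inv by (simp add: invertible_det_nz)
  ultimately show ?thesis using that T inv by blast
qed

lemma pos_def_invertible:
  fixes A :: "complex ^ 'n ^ 'n"
  assumes "pos_def A"
  shows "A ** matrix_inv A = mat 1" "matrix_inv A ** A = mat 1"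
    "A *v (matrix_inv A *v x) = x" "matrix_inv A *v (A *v x) = x"
proof -
  obtain T l where T: "adjoint_mat T ** A ** T = mat 1" "matrix_inv A = T ** adjoint_mat T"
    using pos_def_diagonalization[OF assms pos_def_adjoint[OF assms]] by metis
  have "(adjoint_mat T ** A) ** T = mat 1" using T by (simp add: matrix_mul_assoc)
  then have "T ** (adjoint_mat T ** A) = mat 1" by (simp add: matrix_left_right_inverse)
  then show 1: "matrix_inv A ** A = mat 1" by (simp add: T matrix_mul_assoc)
  then show 2: "A ** matrix_inv A = mat 1" by (simp add: matrix_left_right_inverse)
  show "A *v (matrix_inv A *v x) = x" "matrix_inv A *v (A *v x) = x"
    by (simp_all add: matrix_vector_mul_assoc 1 2)
qed

lemma pos_def_matrix_inv:
  fixes A :: "complex ^ 'n ^ 'n"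
  assumes A: "pos_def A"
  shows "pos_def (matrix_inv A)"
proof -
  obtain T l where T: "matrix_inv A = T ** adjoint_mat T"
    using pos_def_diagonalization[OF assms pos_def_adjoint[OF assms]] by metis
  have "adjoint_mat (matrix_inv A) = matrix_inv A" by (simp add: T adjoint_mult)
  moreover have "0 < (matrix_inv A *v v) \<bullet> v" if "v \<noteq> 0" for v
  proof -
    have "matrix_inv A *v v \<noteq> 0" using that pos_def_invertible(3)[OF A, of v] by auto
    from pos_defD[OF A this] show ?thesis by (simp add: pos_def_invertible[OF A] inner_commute)
  qed
  ultimately show ?thesis by (simp add: pos_def_def)
qed

lemma pos_def_scaleR: "pos_def A \<Longrightarrow> 0 < c \<Longrightarrow> pos_def (c *\<^sub>R A)"
  by (simp add: pos_def_def adjoint_scaleR matrix_scaleR_vector)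

text \<open>Legendre duality: the right side is the maximum over \<open>u\<close> of the left side,
  attained at u = A^{-1} x. The convexity estimates below come from choosing \<open>u\<close> well;
  the proof expands the nonnegative form of \<open>A\<close> at A^{-1} x - u.\<close>

lemma inverse_form_ge:
  fixes A :: "complex ^ 'n ^ 'n"
  assumes A: "pos_def A"
  shows "2 * (x \<bullet> u) - (A *v u) \<bullet> u \<le> (matrix_inv A *v x) \<bullet> x"
proof -
  let ?w = "matrix_inv A *v x"
  have "0 \<le> (A *v (?w - u)) \<bullet> (?w - u)" by (rule pos_def_nonneg[OF A])
  then show ?thesis
    unfolding herm_quadratic_diff[OF pos_def_adjoint[OF A]]
    by (simp add: pos_def_invertible[OF A] inner_commute)
qed

lemma inverse_form_eq:
  fixes A :: "complex ^ 'n ^ 'n"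
  assumes A: "pos_def A"
  shows "(A *v (matrix_inv A *v x)) \<bullet> (matrix_inv A *v x) = (matrix_inv A *v x) \<bullet> x"
  by (simp add: pos_def_invertible[OF A] inner_commute)

text \<open>The maximizer B^{-1} x of the dual problem for \<open>B\<close> is a test vector in the
  one for \<open>A\<close>.\<close>

lemma inverse_form_antimono:
  fixes A B :: "complex ^ 'n ^ 'n"
  assumes A: "pos_def A" and B: "pos_def B" and le: "\<And>u. (A *v u) \<bullet> u \<le> (B *v u) \<bullet> u"
  shows "(matrix_inv B *v x) \<bullet> x \<le> (matrix_inv A *v x) \<bullet> x"
  using inverse_form_ge[OF A, of x "matrix_inv B *v x"] le[of "matrix_inv B *v x"]
    inverse_form_eq[OF B, of x] by (simp add: inner_commute)

text \<open>Duality optimized over the real multiples of \<open>u\<close>.\<close>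

lemma inverse_form_lower:
  fixes A :: "complex ^ 'n ^ 'n"
  assumes A: "pos_def A" and u: "u \<noteq> 0"
  shows "(x \<bullet> u)\<^sup>2 / ((A *v u) \<bullet> u) \<le> (matrix_inv A *v x) \<bullet> x"
proof -
  define a where "a = (A *v u) \<bullet> u"
  have a: "a > 0" using pos_defD[OF A u] by (simp add: a_def)
  define t where "t = (x \<bullet> u) / a"
  have "2 * (x \<bullet> (t *\<^sub>R u)) - (A *v (t *\<^sub>R u)) \<bullet> (t *\<^sub>R u) \<le> (matrix_inv A *v x) \<bullet> x"
    by (rule inverse_form_ge[OF A])
  then have "2 * t * (x \<bullet> u) - t\<^sup>2 * a \<le> (matrix_inv A *v x) \<bullet> x"
    unfolding quadratic_scaleR by (simp add: a_def)
  moreover have "2 * t * (x \<bullet> u) - t\<^sup>2 * a = (x \<bullet> u)\<^sup>2 / a"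
    using a by (simp add: t_def power2_eq_square field_simps)
  ultimately show ?thesis by (simp add: a_def)
qed

lemma matrix_congruence_add: "S ** (X + Y) ** T = S ** X ** T + S ** Y ** T"
  for S X Y T :: "complex ^ 'n ^ 'n"
  by (simp add: matrix_eq matrix_vector_mult_add_rdistrib matrix_vector_right_distrib
      flip: matrix_vector_mul_assoc)

lemma matrix_congruence_diff: "S ** (X - Y) ** T = S ** X ** T - S ** Y ** T"
  for S X Y T :: "complex ^ 'n ^ 'n"
  by (simp add: matrix_eq matrix_vector_mult_diff_rdistrib matrix_vector_mult_diff_distrib
      flip: matrix_vector_mul_assoc)

section \<open>The logarithm of the determinant: monotonicity and quantitative concavity\<close>

definition ldet :: "complex ^ 'n ^ 'n \<Rightarrow> real" where
  "ldet A = ln (Re (det A))"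

lemma det_congruence_diag:
  assumes "adjoint_mat T ** X ** T = diag m"
  shows "of_real ((cmod (det T))\<^sup>2) * det X = of_real (\<Prod>i\<in>UNIV. m i)"
  by (metis assms congruence_det det_diag)

lemma Re_det_congruence_diag:
  assumes "adjoint_mat T ** X ** T = diag m"
  shows "(cmod (det T))\<^sup>2 * Re (det X) = (\<Prod>i\<in>UNIV. m i)"
  using arg_cong[OF det_congruence_diag[OF assms], of Re] by (simp del: of_real_prod)

lemma pos_def_det:
  fixes A :: "complex ^ 'n ^ 'n"
  assumes A: "pos_def A"
  shows "det A = of_real (Re (det A))" "Re (det A) > 0"
proof -
  obtain T l where T: "adjoint_mat T ** A ** T = mat 1" "det T \<noteq> 0"
    using pos_def_diagonalization[OF A pos_def_adjoint[OF A]] by metis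
  have d: "adjoint_mat T ** A ** T = diag (\<lambda>i. 1)" by (simp add: T diag_one)
  show "det A = of_real (Re (det A))"
    using det_adjoint[of A] pos_def_adjoint[OF A] by (simp add: complex_eq_iff)
  show "Re (det A) > 0"
    using Re_det_congruence_diag[OF d] T(2) zero_less_mult_pos[of "(cmod (det T))\<^sup>2" "Re (det A)"]
    by simp
qed

text \<open>Relative to \<open>B\<close>, the eigenvalues of \<open>A\<close> lie in [0, 1], so
  their product is at most 1.\<close>

lemma ldet_mono:
  fixes A B :: "complex ^ 'n ^ 'n"
  assumes A: "pos_def A" and B: "pos_def B" and le: "\<And>u. (A *v u) \<bullet> u \<le> (B *v u) \<bullet> u"
  shows "ldet A \<le> ldet B"
proof -
  obtain T l where T: "adjoint_mat T ** B ** T = mat 1" "adjoint_mat T ** A ** T = diag l" "det T \<noteq> 0"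
    using pos_def_diagonalization[OF B pos_def_adjoint[OF A]] by metis
  have l: "0 \<le> l i \<and> l i \<le> 1" for i
  proof -
    let ?z = "axis i 1 :: complex ^ 'n"
    have "l i = (A *v (T *v ?z)) \<bullet> (T *v ?z)"
      by (metis T(2) congruence_quadratic diag_quadratic_axis)
    moreover have "1 = (B *v (T *v ?z)) \<bullet> (T *v ?z)"
      by (metis T(1) congruence_quadratic diag_quadratic_axis diag_one)
    ultimately show ?thesis using le[of "T *v ?z"] pos_def_nonneg[OF A, of "T *v ?z"] by simp
  qed
  have "(cmod (det T))\<^sup>2 * Re (det A) \<le> 1"
    unfolding Re_det_congruence_diag[OF T(2)] using l by (intro prod_le_1) auto
  also have "1 = (cmod (det T))\<^sup>2 * Re (det B)"
    using Re_det_congruence_diag[of T B "\<lambda>i. 1"] T(1) by (simp add: diag_one)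
  finally have "Re (det A) \<le> Re (det B)" using T(3) by simp
  then show ?thesis using pos_def_det(2)[OF A] by (simp add: ldet_def)
qed

lemma ldet_matrix_inv:
  fixes A :: "complex ^ 'n ^ 'n"
  assumes A: "pos_def A"
  shows "ldet (matrix_inv A) = - ldet A"
proof -
  have "det A * det (matrix_inv A) = 1"
    by (metis A det_I det_mul pos_def_invertible(1))
  then have "of_real (Re (det A) * Re (det (matrix_inv A))) = (1::complex)"
    by (metis A of_real_mult pos_def_det(1) pos_def_matrix_inv)
  then have "Re (det A) * Re (det (matrix_inv A)) = 1"
    by (metis of_real_eq_1_iff)
  then have "Re (det (matrix_inv A)) = inverse (Re (det A))"
    by (metis inverse_unique)
  then show ?thesis using pos_def_det(2)[OF A] by (simp add: ldet_def ln_inverse)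
qed

lemma ldet_scaleR:
  fixes A :: "complex ^ 'n ^ 'n"
  assumes A: "pos_def A" and c: "c > 0"
  shows "ldet (c *\<^sub>R A) = real CARD('n) * ln c + ldet A"
proof -
  have e: "c *\<^sub>R A = diag (\<lambda>i. c) ** A"
    by (simp add: matrix_eq flip: matrix_vector_mul_assoc)
       (simp add: vec_eq_iff diag_mult_vector matrix_scaleR_vector)
  have "Re (det (c *\<^sub>R A)) = c ^ CARD('n) * Re (det A)"
    unfolding e det_mul det_diag by simp
  then show ?thesis using c pos_def_det(2)[OF A]
    by (simp add: ldet_def ln_mult ln_realpow)
qed

text \<open>The eigenvalues l of \<open>D\<close> relative to \<open>A\<close> lie in (-1, 1), and
  the concavity gap is the sum of -ln(1 - l^2), which is at least the sum of the l^2. This sum is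
  \<mu>; it also dominates the largest l^2, which gives D A^{-1} D \<le> \<mu> A.\<close>

lemma ldet_strict_concavity:
  fixes A D :: "complex ^ 'n ^ 'n"
  assumes plus: "pos_def (A + D)" and minus: "pos_def (A - D)" and A: "pos_def A"
    and D: "adjoint_mat D = D"
  obtains \<mu> where "0 \<le> \<mu>"
    "\<And>u. (matrix_inv A *v (D *v u)) \<bullet> (D *v u) \<le> \<mu> * ((A *v u) \<bullet> u)"
    "\<mu> \<le> 2 * ldet A - ldet (A + D) - ldet (A - D)"
proof -
  obtain T l where T: "adjoint_mat T ** A ** T = mat 1" "adjoint_mat T ** D ** T = diag l"
    "D ** T = A ** T ** diag l" "invertible T" "det T \<noteq> 0"
    using pos_def_diagonalization[OF A D] by metis
  define \<mu> where "\<mu> = (\<Sum>i\<in>UNIV. (l i)\<^sup>2)"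
  have Tp: "adjoint_mat T ** (A + D) ** T = diag (\<lambda>i. 1 + l i)"
    and Tm: "adjoint_mat T ** (A - D) ** T = diag (\<lambda>i. 1 - l i)"
    by (simp_all add: matrix_congruence_add matrix_congruence_diff T diag_add diag_diff flip: diag_one)
  have l: "1 + l i > 0 \<and> 1 - l i > 0" for i
  proof -
    let ?z = "axis i 1 :: complex ^ 'n"
    have z: "T *v ?z \<noteq> 0"
    proof
      assume "T *v ?z = 0"
      then have "?z = 0" using T(4) invertible_left_inverse matrix_left_invertible_ker by blast
      then show False by simp
    qed
    have "1 + l i = ((A + D) *v (T *v ?z)) \<bullet> (T *v ?z)"
      by (metis Tp congruence_quadratic diag_quadratic_axis)
    moreover have "1 - l i = ((A - D) *v (T *v ?z)) \<bullet> (T *v ?z)"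
      by (metis Tm congruence_quadratic diag_quadratic_axis)
    ultimately show ?thesis using pos_defD[OF plus z] pos_defD[OF minus z] by simp
  qed
  define c where "c = (cmod (det T))\<^sup>2"
  have c: "c > 0" using T(5) by (simp add: c_def)
  have ln_det: "ln c + ldet X = (\<Sum>i\<in>UNIV. ln (m i))"
    if "adjoint_mat T ** X ** T = diag m" "\<And>i. m i > 0" "pos_def X" for X m
  proof -
    have "ln (c * Re (det X)) = ln (\<Prod>i\<in>UNIV. m i)"
      using Re_det_congruence_diag[OF that(1)] by (simp add: c_def)
    moreover have "ln (\<Prod>i\<in>UNIV. m i) = (\<Sum>i\<in>UNIV. ln (m i))"
      by (intro ln_prod) (use that(2) in \<open>auto simp: less_le\<close>)
    ultimately show ?thesis using c pos_def_det(2)[OF that(3)]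
      by (simp add: ldet_def ln_mult)
  qed
  have "ln c + ldet A = 0" using ln_det[of A "\<lambda>i. 1"] T(1) A by (simp add: diag_one)
  moreover have "ln c + ldet (A + D) = (\<Sum>i\<in>UNIV. ln (1 + l i))"
    using ln_det[OF Tp] l plus by simp
  moreover have "ln c + ldet (A - D) = (\<Sum>i\<in>UNIV. ln (1 - l i))"
    using ln_det[OF Tm] l minus by simp
  ultimately have gap: "2 * ldet A - ldet (A + D) - ldet (A - D)
      = (\<Sum>i\<in>UNIV. - (ln (1 + l i) + ln (1 - l i)))"
    by (simp add: sum.distrib sum_negf sum_subtractf)
  have "\<mu> \<le> (\<Sum>i\<in>UNIV. - (ln (1 + l i) + ln (1 - l i)))"
    unfolding \<mu>_def
  proof (rule sum_mono)
    fix i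
    have p: "(1 + l i) * (1 - l i) = 1 - (l i)\<^sup>2" by (simp add: power2_eq_square algebra_simps)
    have pp: "(1 + l i) * (1 - l i) > 0" using l[of i] by simp
    have "ln (1 + l i) + ln (1 - l i) = ln ((1 + l i) * (1 - l i))"
      using l[of i] by (simp add: ln_mult)
    also have "\<dots> \<le> (1 + l i) * (1 - l i) - 1" by (rule ln_le_minus_one[OF pp])
    finally show "(l i)\<^sup>2 \<le> - (ln (1 + l i) + ln (1 - l i))" by (simp add: p)
  qed
  then have 3: "\<mu> \<le> 2 * ldet A - ldet (A + D) - ldet (A - D)" by (simp add: gap)
  have 2: "(matrix_inv A *v (D *v u)) \<bullet> (D *v u) \<le> \<mu> * ((A *v u) \<bullet> u)" for u
  proof -
    obtain z where z: "u = T *v z"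
      by (metis T(4) invertible_right_inverse matrix_vector_mul_assoc matrix_vector_mul_lid)
    let ?y = "diag l *v z"
    have nT: "(A *v (T *v y)) \<bullet> (T *v y) = (norm y)\<^sup>2" for y
      using congruence_quadratic[of T A y] by (simp add: T(1) power2_norm_eq_inner)
    have "D *v u = (D ** T) *v z" by (simp add: z matrix_vector_mul_assoc)
    then have Du: "D *v u = A *v (T *v ?y)"
      by (simp add: T(3) matrix_vector_mul_assoc matrix_mul_assoc)
    have "(matrix_inv A *v (D *v u)) \<bullet> (D *v u) = (norm ?y)\<^sup>2"
      using nT[of ?y] by (simp add: Du pos_def_invertible[OF A] inner_commute)
    also have "\<dots> = (\<Sum>i\<in>UNIV. (l i)\<^sup>2 * (norm (z $ i))\<^sup>2)"
      by (simp add: norm_sq_vec diag_mult_vector power_mult_distrib)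
    also have "\<dots> \<le> (\<Sum>i\<in>UNIV. \<mu> * (norm (z $ i))\<^sup>2)"
      by (intro sum_mono mult_right_mono) (auto simp: \<mu>_def intro: member_le_sum)
    also have "\<dots> = \<mu> * ((A *v u) \<bullet> u)"
      by (simp add: nT z norm_sq_vec sum_distrib_left)
    finally show ?thesis .
  qed
  have "0 \<le> \<mu>" by (simp add: \<mu>_def sum_nonneg)
  with 2 3 show ?thesis using that by blast
qed

section \<open>Convexity of the form (A^{-1} x, x) jointly in the matrix and the vector\<close>

definition inv_form :: "complex ^ 'n ^ 'n \<Rightarrow> complex ^ 'n \<Rightarrow> real" where
  "inv_form A x = (matrix_inv A *v x) \<bullet> x"

lemma inv_form_nonneg: "pos_def A \<Longrightarrow> 0 \<le> inv_form A x"
  unfolding inv_form_def by (rule pos_def_nonneg[OF pos_def_matrix_inv])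

text \<open>The parallelogram law with the term at \<open>x - y\<close> dropped.\<close>

lemma inv_form_add_le:
  assumes "pos_def A"
  shows "inv_form A (x + y) \<le> 2 * inv_form A x + 2 * inv_form A y"
proof -
  note h = pos_def_matrix_inv[OF assms]
  have "0 \<le> inv_form A (x - y)" using assms by (rule inv_form_nonneg)
  then show ?thesis
    unfolding inv_form_def herm_quadratic_add[OF pos_def_adjoint[OF h]]
      herm_quadratic_diff[OF pos_def_adjoint[OF h]] by simp
qed

text \<open>This turns V \<le> Q W^{-1} into W \<le> Q V^{-1}, by duality for \<open>V\<close> with
  the test vector W e / Q.\<close>

lemma quadratic_form_le_inv_form:
  fixes V W :: "complex ^ 'n ^ 'n"
  assumes V: "pos_def V" and W: "pos_def W" and Q: "Q > 0"
    and VW: "\<And>u. (V *v u) \<bullet> u \<le> Q * inv_form W u"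
  shows "(W *v e) \<bullet> e \<le> Q * inv_form V e"
proof -
  define b where "b = (W *v e) \<bullet> e"
  have "2 * (e \<bullet> ((1/Q) *\<^sub>R (W *v e))) - (V *v ((1/Q) *\<^sub>R (W *v e))) \<bullet> ((1/Q) *\<^sub>R (W *v e))
      \<le> inv_form V e"
    unfolding inv_form_def by (rule inverse_form_ge[OF V])
  then have 1: "2 * (b / Q) - (1/Q)\<^sup>2 * ((V *v (W *v e)) \<bullet> (W *v e)) \<le> inv_form V e"
    unfolding quadratic_scaleR by (simp add: b_def inner_commute)
  have "(V *v (W *v e)) \<bullet> (W *v e) \<le> Q * b"
    using VW[of "W *v e"] by (simp add: inv_form_def pos_def_invertible[OF W] b_def inner_commute)
  then have "(1/Q)\<^sup>2 * ((V *v (W *v e)) \<bullet> (W *v e)) \<le> (1/Q)\<^sup>2 * (Q * b)"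
    by (intro mult_left_mono) auto
  also have "(1/Q)\<^sup>2 * (Q * b) = b / Q" using Q by (simp add: power2_eq_square)
  finally have "b / Q \<le> inv_form V e" using 1 by linarith
  then show ?thesis using Q by (simp add: b_def field_simps)
qed

text \<open>Duality is applied at u + w and u - w. Here u = V^{-1} x is the maximizer at the
  midpoint, and w = V^{-1}(e - D u) maximizes what is left after adding the two bounds. The gain
  measures the part of the jump of \<open>x\<close> that the jump of \<open>V\<close> does not
  account for.\<close>

lemma inv_form_midpoint:
  fixes V D :: "complex ^ 'n ^ 'n"
  assumes plus: "pos_def (V + D)" and minus: "pos_def (V - D)" and V: "pos_def V"
  shows "2 * inv_form V x + 2 * inv_form V (e - D *v (matrix_inv V *v x))
    \<le> inv_form (V + D) (x + e) + inv_form (V - D) (x - e)"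
proof -
  define u where "u = matrix_inv V *v x"
  define w where "w = matrix_inv V *v (e - D *v u)"
  have Vu: "V *v u = x" and Vw: "V *v w = e - D *v u"
    by (simp_all add: u_def w_def pos_def_invertible[OF V])
  have "adjoint_mat (V + D) - adjoint_mat V = D"
    using plus V by (simp add: pos_def_adjoint)
  then have D: "adjoint_mat D = D" by (simp add: adjoint_add)
  have "2 * ((x + e) \<bullet> (u + w)) - ((V + D) *v (u + w)) \<bullet> (u + w) \<le> inv_form (V + D) (x + e)"
    unfolding inv_form_def by (rule inverse_form_ge[OF plus])
  moreover have "2 * ((x - e) \<bullet> (u - w)) - ((V - D) *v (u - w)) \<bullet> (u - w) \<le> inv_form (V - D) (x - e)"
    unfolding inv_form_def by (rule inverse_form_ge[OF minus])
  moreover have "2 * ((x + e) \<bullet> (u + w)) - ((V + D) *v (u + w)) \<bullet> (u + w)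
      + (2 * ((x - e) \<bullet> (u - w)) - ((V - D) *v (u - w)) \<bullet> (u - w))
      = 4 * (x \<bullet> u) - 2 * ((V *v u) \<bullet> u) + 4 * ((e - D *v u) \<bullet> w) - 2 * ((V *v w) \<bullet> w)"
    using herm_inner[OF D, of w u] herm_inner[OF pos_def_adjoint[OF V], of w u]
    by (simp add: matrix_vector_mult_add_rdistrib matrix_vector_mult_diff_rdistrib
        matrix_vector_right_distrib matrix_vector_mult_diff_distrib inner_add_left inner_add_right
        inner_diff_left inner_diff_right inner_commute algebra_simps)
  moreover have "(V *v u) \<bullet> u = inv_form V x" "x \<bullet> u = inv_form V x"
    unfolding Vu by (simp_all add: inv_form_def u_def inner_commute)
  moreover have "(V *v w) \<bullet> w = inv_form V (e - D *v u)" "(e - D *v u) \<bullet> w = inv_form V (e - D *v u)"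
    unfolding Vw by (simp_all add: inv_form_def w_def inner_commute)
  ultimately show ?thesis unfolding u_def[symmetric] by linarith
qed

text \<open>The same test vector Z^{-1} x serves both halves, so \<open>e\<close> cancels and the
  slack in \<open>mid\<close> survives as a multiple of the form of \<open>V\<close> at this vector.
  The bound Z \<le> 2 V then compares that form with V^{-1} at \<open>x\<close>.\<close>

lemma inv_form_midpoint_gain:
  fixes V Z Z1 Z2 :: "complex ^ 'n ^ 'n"
  assumes Z1: "pos_def Z1" and Z2: "pos_def Z2" and Z: "pos_def Z" and V: "pos_def V"
    and k: "k \<ge> 0" and ZV: "\<And>u. (Z *v u) \<bullet> u \<le> 2 * ((V *v u) \<bullet> u)"
    and mid: "\<And>u. (Z1 *v u) \<bullet> u + (Z2 *v u) \<bullet> u \<le> 2 * ((Z *v u) \<bullet> u) - 2 * k * ((V *v u) \<bullet> u)"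
  shows "2 * inv_form Z x + k / 2 * inv_form V x \<le> inv_form Z1 (x + e) + inv_form Z2 (x - e)"
proof -
  define u where "u = matrix_inv Z *v x"
  define v where "v = matrix_inv V *v x"
  have Zu: "(Z *v u) \<bullet> u = inv_form Z x" "x \<bullet> u = inv_form Z x"
    by (simp_all add: inv_form_def u_def pos_def_invertible[OF Z] inner_commute)
  have Vv: "(V *v v) \<bullet> v = inv_form V x" "x \<bullet> v = inv_form V x"
    by (simp_all add: inv_form_def v_def pos_def_invertible[OF V] inner_commute)
  have "2 * ((x + e) \<bullet> u) - (Z1 *v u) \<bullet> u \<le> inv_form Z1 (x + e)"
    unfolding inv_form_def by (rule inverse_form_ge[OF Z1])
  moreover have "2 * ((x - e) \<bullet> u) - (Z2 *v u) \<bullet> u \<le> inv_form Z2 (x - e)"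
    unfolding inv_form_def by (rule inverse_form_ge[OF Z2])
  ultimately have 1: "2 * inv_form Z x + 2 * k * ((V *v u) \<bullet> u) \<le> inv_form Z1 (x + e) + inv_form Z2 (x - e)"
    using mid[of u] Zu by (simp add: inner_add_left inner_diff_left)
  \<comment> \<open>Among the multiples s v, the lower bound 2 s - 2 s^2 coming from Z \<le> 2 V is
    largest at s = 1/2.\<close>
  have "2 * (x \<bullet> ((1/2) *\<^sub>R v)) - (Z *v ((1/2) *\<^sub>R v)) \<bullet> ((1/2) *\<^sub>R v) \<le> inv_form Z x"
    unfolding inv_form_def by (rule inverse_form_ge[OF Z])
  then have "inv_form V x - (1/4) * ((Z *v v) \<bullet> v) \<le> inv_form Z x"
    unfolding quadratic_scaleR by (simp add: Vv power2_eq_square)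
  then have "inv_form V x \<le> 4 * ((V *v u) \<bullet> u)"
    using ZV[of v] ZV[of u] by (simp add: Vv Zu)
  then have "k * inv_form V x \<le> k * (4 * ((V *v u) \<bullet> u))" using k by (intro mult_left_mono)
  with 1 show ?thesis by simp
qed

text \<open>Midpoint convexity of 1/(p m) on the positive quadrant, with denominators
  cleared.\<close>

lemma reciprocal_product_convex:
  fixes p r m n :: real
  assumes "p > 0" "r > 0" "m > 0" "n > 0"
  shows "8 / ((p + r) * (m + n)) \<le> 1 / (p * m) + 1 / (r * n)"
proof -
  define a b where "a = p * m" and "b = r * n"
  have ab: "a > 0" "b > 0" using assms by (auto simp: a_def b_def)
  have "(p * n + r * m)\<^sup>2 - 4 * (a * b) = (p * n - r * m)\<^sup>2"
    by (simp add: power2_eq_square a_def b_def algebra_simps)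
  then have s: "(p * n + r * m)\<^sup>2 \<ge> 4 * (a * b)" by (metis diff_ge_0_iff_ge zero_le_power2)
  have pm: "(p + r) * (m + n) = a + b + (p * n + r * m)" by (simp add: a_def b_def algebra_simps)
  define c where "c = p * n + r * m"
  have c: "c > 0" using assms by (simp add: c_def add_pos_pos)
  have "8 * (a * b) \<le> (a + b) * (a + b + c)"
  proof -
    \<comment> \<open>By the inequality of arithmetic and geometric means, both \<open>a + b\<close>
      and the cross sum \<open>c\<close> are at least \<open>2 * q\<close>, since their summands
      have the same product \<open>a * b\<close>.\<close>
    define q where "q = sqrt (a * b)"
    have q: "q \<ge> 0" "q\<^sup>2 = a * b" using ab by (auto simp: q_def)
    have q2: "(2 * q)\<^sup>2 = 4 * (a * b)" by (simp add: power_mult_distrib q(2))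
    have "(a + b)\<^sup>2 - 4 * (a * b) = (a - b)\<^sup>2"
      by (simp add: power2_eq_square algebra_simps)
    then have "4 * (a * b) \<le> (a + b)\<^sup>2" by (metis diff_ge_0_iff_ge zero_le_power2)
    then have s1: "2 * q \<le> a + b"
      unfolding q2[symmetric] by (rule power2_le_imp_le) (use ab in simp)
    have c1: "2 * q \<le> c"
      using s unfolding q2[symmetric] c_def[symmetric]
      by (rule power2_le_imp_le) (use c in simp)
    have "8 * (a * b) = (2 * q) * (2 * q + 2 * q)"
      unfolding q(2)[symmetric] power2_eq_square by simp
    also have "\<dots> \<le> (a + b) * (a + b + c)"
      by (rule mult_mono[OF s1 add_mono[OF s1 c1]]) (use ab q(1) in simp_all)
    finally show ?thesis .
  qed
  then have "8 / (a + b + c) \<le> (a + b) / (a * b)"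
    using ab c by (simp add: divide_simps mult_ac)
  also have "(a + b) / (a * b) = 1 / a + 1 / b" using ab by (simp add: divide_simps)
  finally show ?thesis by (simp add: pm a_def b_def c_def)
qed

text \<open>
  The extra term on the left comes from the slack \<open>d\<close> by which \<open>m\<close> exceeds the midpoint of \<open>m1\<close>
  and \<open>m2\<close>.
\<close>

lemma inv_form_quotient_convex:
  fixes W G :: "complex ^ 'n ^ 'n"
  assumes plus: "pos_def (W + G)" and minus: "pos_def (W - G)" and W: "pos_def W"
    and m: "m1 > 0" "m2 > 0" "m1 \<le> 2" "m2 \<le> 2" "m > 0" "m \<le> 2"
    and d: "d \<ge> 0" "m1 + m2 \<le> 2 * m - 2 * d"
  shows "2 * inv_form W u / m + d / 2 * inv_form W u
    \<le> inv_form (W + G) u / m1 + inv_form (W - G) u / m2"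
proof (cases "u = 0")
  case True
  then show ?thesis by (simp add: inv_form_def)
next
  case False
  \<comment> \<open>Testing at the maximizer for \<open>W\<close> reduces the claim to scalars: the
    forms of W + G and W - G at \<open>w\<close> are \<open>a\<close> and \<open>b\<close> with
    \<open>a + b = 2 * c\<close>, and duality is exact at the midpoint.\<close>
  define w where "w = matrix_inv W *v u"
  define c where "c = inv_form W u"
  have Wu: "W *v w = u" by (simp add: w_def pos_def_invertible[OF W])
  then have w0: "w \<noteq> 0" using False by auto
  have c: "c = (W *v w) \<bullet> w" "u \<bullet> w = c" by (simp_all add: c_def inv_form_def w_def pos_def_invertible[OF W] inner_commute)
  have c0: "c > 0" using pos_defD[OF W w0] c by simp
  define a b where "a = ((W + G) *v w) \<bullet> w" and "b = ((W - G) *v w) \<bullet> w"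
  have ab: "a > 0" "b > 0" using pos_defD[OF plus w0] pos_defD[OF minus w0] by (auto simp: a_def b_def)
  have abc: "a + b = 2 * c"
    by (simp add: a_def b_def c matrix_vector_mult_add_rdistrib matrix_vector_mult_diff_rdistrib
        inner_add_left inner_diff_left)
  have 1: "c\<^sup>2 / a \<le> inv_form (W + G) u" "c\<^sup>2 / b \<le> inv_form (W - G) u"
    using inverse_form_lower[OF plus w0, of u] inverse_form_lower[OF minus w0, of u]
    by (simp_all add: c a_def b_def inv_form_def)
  \<comment> \<open>The true midpoint \<open>n\<close> of \<open>m1\<close> and \<open>m2\<close>
    lies at least \<open>d\<close> below \<open>m\<close>; together with
    \<open>m * n \<le> 4\<close> this becomes a gain of \<open>d / 4\<close> in the
    reciprocals.\<close>
  define n where "n = (m1 + m2) / 2"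
  have n: "n > 0" "n \<le> 2" "n \<le> m - d" using m d by (auto simp: n_def)
  have "d / 4 \<le> (m - n) / (m * n)"
  proof -
    have "d / 4 \<le> (m - n) / 4" using n by simp
    also have "m * n \<le> 2 * 2" using m n by (intro mult_mono) auto
    then have "(m - n) / 4 \<le> (m - n) / (m * n)" using m n d
      by (intro divide_left_mono) auto
    finally show ?thesis .
  qed
  also have "(m - n) / (m * n) = 1 / n - 1 / m" using m n by (simp add: field_simps)
  finally have "2 * c * (1 / m + d / 4) \<le> 2 * c * (1 / n)" using c0 by (intro mult_left_mono) auto
  also have "2 * c * (1 / n) = c\<^sup>2 * (8 / ((a + b) * (m1 + m2)))"
  proof -
    have "(a + b) * (m1 + m2) = 4 * (c * n)" by (simp add: abc n_def)
    then show ?thesis using c0 n by (simp add: power2_eq_square)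
  qed
  also have "\<dots> \<le> c\<^sup>2 * (1 / (a * m1) + 1 / (b * m2))"
    by (intro mult_left_mono reciprocal_product_convex ab m) auto
  also have "\<dots> = c\<^sup>2 / a / m1 + c\<^sup>2 / b / m2" by (simp add: distrib_left)
  also have "\<dots> \<le> inv_form (W + G) u / m1 + inv_form (W - G) u / m2"
    using m 1 by (intro add_mono divide_right_mono) auto
  finally show ?thesis by (simp add: c_def distrib_left)
qed

subsection \<open>The Bellman function\<close>

text \<open>These are the constraints satisfied by averages over an interval: W^{-1} \<le> V is
  Jensen's inequality, V \<le> Q W^{-1} is the \<open>A_2\<close> condition, and the last one is
  Cauchy-Schwarz.\<close>

definition bellman_domain ::
    "real \<Rightarrow> complex ^ 'n ^ 'n \<Rightarrow> complex ^ 'n ^ 'n \<Rightarrow> complex ^ 'n \<Rightarrow> real \<Rightarrow> bool" where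
  "bellman_domain Q V W x F \<longleftrightarrow> pos_def V \<and> pos_def W \<and>
     (\<forall>u. inv_form W u \<le> (V *v u) \<bullet> u) \<and> (\<forall>u. (V *v u) \<bullet> u \<le> Q * inv_form W u) \<and>
     inv_form V x \<le> F"

text \<open>An upper bound for \<open>ldet V + ldet W\<close> on the Bellman domain. The summand 1
  keeps it positive at Q = 1, since it is used as a divisor; the type argument carries the
  dimension.\<close>

definition ldet_range :: "'n itself \<Rightarrow> real \<Rightarrow> real" where
  "ldet_range _ Q = real CARD('n) * (1 + ln Q)"

text \<open>An affine rescaling of \<open>ldet V + ldet W\<close> that keeps its concavity and takes
  values in [1, 2] on the Bellman domain, so that it can serve as a divisor.\<close>

definition ldet_weight :: "real \<Rightarrow> complex ^ 'n ^ 'n \<Rightarrow> complex ^ 'n ^ 'n \<Rightarrow> real" where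
  "ldet_weight Q V W = 1 + (ldet V + ldet W) / ldet_range TYPE('n) Q"

text \<open>
  The matrix \<open>Z\<close> above: the concavity gain of \<open>ldet_weight\<close> becomes a convexity gain of the
  subtracted term, so the mean of \<open>Z\<close> over the two halves of an interval lies below \<open>Z\<close>.
\<close>

definition damped_weight ::
    "real \<Rightarrow> complex ^ 'n ^ 'n \<Rightarrow> complex ^ 'n ^ 'n \<Rightarrow> complex ^ 'n ^ 'n" where
  "damped_weight Q V W = 2 *\<^sub>R V - (1 / ldet_weight Q V W) *\<^sub>R matrix_inv W"

text \<open>
  The factor \<open>64 Q L\<close>, with \<open>L\<close> the value of \<open>ldet_range\<close>, turns the gain \<open>\<mu> / (16 Q L)\<close> of the second
  form into the \<open>4 \<mu>\<close> needed to absorb the term of the interval.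
\<close>

definition bellman ::
    "real \<Rightarrow> complex ^ 'n ^ 'n \<Rightarrow> complex ^ 'n ^ 'n \<Rightarrow> complex ^ 'n \<Rightarrow> real \<Rightarrow> real" where
  "bellman Q V W x F = Q * (2 * (F - inv_form V x)
     + 64 * Q * ldet_range TYPE('n) Q * (F - inv_form (damped_weight Q V W) x))"

text \<open>The two matrix inequalities combine to W^{-1} \<le> Q W^{-1}, which is tested at one
  nonzero vector.\<close>

lemma bellman_domain_ge_1:
  fixes V W :: "complex ^ 'n ^ 'n"
  assumes "bellman_domain Q V W x F"
  shows "Q \<ge> 1"
proof -
  note B = assms[unfolded bellman_domain_def]
  let ?u = "axis undefined 1 :: complex ^ 'n"
  have "?u \<noteq> 0" by simp
  then have "inv_form W ?u > 0"
    unfolding inv_form_def using B by (intro pos_defD[OF pos_def_matrix_inv]) auto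
  moreover have "1 * inv_form W ?u \<le> Q * inv_form W ?u" using B by (auto intro: order_trans)
  ultimately show ?thesis by (metis mult_le_cancel_right_pos)
qed

lemma ldet_range_pos: "Q \<ge> 1 \<Longrightarrow> ldet_range TYPE('n::finite) Q > 0"
  by (simp add: ldet_range_def add_pos_nonneg)

text \<open>Monotonicity of \<open>ldet\<close> along W^{-1} \<le> V \<le> Q W^{-1} places
  \<open>ldet V + ldet W\<close> between 0 and d ln Q.\<close>

lemma ldet_weight_bounds:
  fixes V W :: "complex ^ 'n ^ 'n"
  assumes "bellman_domain Q V W x F"
  shows "1 \<le> ldet_weight Q V W" "ldet_weight Q V W \<le> 2"
proof -
  note B = assms[unfolded bellman_domain_def]
  have V: "pos_def V" and W: "pos_def W" using B by auto
  have Q: "Q \<ge> 1" by (rule bellman_domain_ge_1[OF assms])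
  note L = ldet_range_pos[OF Q, where 'n='n]
  have "ldet (matrix_inv W) \<le> ldet V"
    using B by (intro ldet_mono pos_def_matrix_inv) (auto simp: inv_form_def)
  then have "0 \<le> ldet V + ldet W" by (simp add: ldet_matrix_inv[OF W])
  then show "1 \<le> ldet_weight Q V W" using L by (simp add: ldet_weight_def)
  have "ldet V \<le> ldet (Q *\<^sub>R matrix_inv W)"
    using B Q by (intro ldet_mono pos_def_scaleR pos_def_matrix_inv)
      (auto simp: inv_form_def matrix_scaleR_vector)
  also have "\<dots> = real CARD('n) * ln Q - ldet W"
    using Q by (simp add: ldet_scaleR pos_def_matrix_inv ldet_matrix_inv W)
  finally have "ldet V + ldet W \<le> ldet_range TYPE('n) Q"
    by (simp add: ldet_range_def distrib_left)
  then show "ldet_weight Q V W \<le> 2" using L by (simp add: ldet_weight_def)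
qed

lemma damped_weight_form:
  "(damped_weight Q V W *v u) \<bullet> u = 2 * ((V *v u) \<bullet> u) - inv_form W u / ldet_weight Q V W"
  by (simp add: damped_weight_def matrix_vector_mult_diff_rdistrib matrix_scaleR_vector
      inner_diff_left inv_form_def)

text \<open>The subtracted term lies between 0 and \<open>V\<close>, because W^{-1} \<le> V and the
  divisor is at least 1.\<close>

lemma damped_weight_bounds:
  fixes V W :: "complex ^ 'n ^ 'n"
  assumes "bellman_domain Q V W x F"
  shows "(V *v u) \<bullet> u \<le> (damped_weight Q V W *v u) \<bullet> u"
    "(damped_weight Q V W *v u) \<bullet> u \<le> 2 * ((V *v u) \<bullet> u)"
    "pos_def (damped_weight Q V W)"
proof -
  note B = assms[unfolded bellman_domain_def]
  note m = ldet_weight_bounds[OF assms]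
  have V: "pos_def V" and W: "pos_def W" using B by auto
  have "inv_form W u / ldet_weight Q V W \<le> inv_form W u / 1"
    for u using m inv_form_nonneg[OF W, of u] by (intro divide_left_mono) auto
  then have 1: "(V *v u) \<bullet> u \<le> (damped_weight Q V W *v u) \<bullet> u" for u
    using B[THEN conjunct2, THEN conjunct2, THEN conjunct1, rule_format, of u]
    unfolding damped_weight_form by (smt (verit) div_by_1)
  then show "(V *v u) \<bullet> u \<le> (damped_weight Q V W *v u) \<bullet> u" .
  show "(damped_weight Q V W *v u) \<bullet> u \<le> 2 * ((V *v u) \<bullet> u)"
    unfolding damped_weight_form using m inv_form_nonneg[OF W, of u] by simp
  have "adjoint_mat (damped_weight Q V W) = damped_weight Q V W"
    using pos_def_adjoint[OF V] pos_def_adjoint[OF pos_def_matrix_inv[OF W]]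
    by (simp add: damped_weight_def adjoint_diff adjoint_scaleR)
  moreover have "0 < (damped_weight Q V W *v v) \<bullet> v" if "v \<noteq> 0" for v
    using 1[of v] pos_defD[OF V that] by simp
  ultimately show "pos_def (damped_weight Q V W)" by (simp add: pos_def_def)
qed

text \<open>Since \<open>V\<close> lies below the damped weight, the inverse forms are ordered the
  other way and both differences with \<open>F\<close> are nonnegative. The upper bound drops the
  subtracted forms.\<close>

lemma bellman_bounds:
  fixes V W :: "complex ^ 'n ^ 'n"
  assumes "bellman_domain Q V W x F"
  shows "0 \<le> bellman Q V W x F"
    "bellman Q V W x F \<le> (2 + 64 * real CARD('n)) * Q\<^sup>2 * (1 + ln Q) * F"
proof -
  note B = assms[unfolded bellman_domain_def]
  have V: "pos_def V" using B by auto
  have Q: "Q \<ge> 1" by (rule bellman_domain_ge_1[OF assms])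
  let ?L = "ldet_range TYPE('n) Q" and ?Z = "damped_weight Q V W"
  have L: "?L > 0" by (rule ldet_range_pos[OF Q])
  have q0: "0 \<le> inv_form V x" "0 \<le> inv_form ?Z x"
    using V damped_weight_bounds(3)[OF assms] by (simp_all add: inv_form_nonneg)
  have qF: "inv_form V x \<le> F" using B by simp
  then have F: "F \<ge> 0" using q0 by simp
  have "inv_form ?Z x \<le> inv_form V x"
    unfolding inv_form_def
    by (intro inverse_form_antimono V damped_weight_bounds(1)[OF assms] damped_weight_bounds(3)[OF assms])
  with qF have "inv_form ?Z x \<le> F" by simp
  with qF Q L show "0 \<le> bellman Q V W x F"
    unfolding bellman_def by (intro mult_nonneg_nonneg add_nonneg_nonneg) auto
  have "bellman Q V W x F \<le> Q * (2 * F + 64 * Q * ?L * F)"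
    unfolding bellman_def using Q L q0 by (intro mult_left_mono add_mono) auto
  also have "\<dots> = 2 * (Q * F) + 64 * real CARD('n) * (Q\<^sup>2 * (1 + ln Q) * F)"
    by (simp add: ldet_range_def power2_eq_square algebra_simps)
  \<comment> \<open>The lower-order term is absorbed into the main one, using Q \<ge> 1.\<close>
  also have "Q * F \<le> Q\<^sup>2 * (1 + ln Q) * F"
  proof -
    have "Q * 1 \<le> Q * (Q * (1 + ln Q))"
      using Q mult_mono[of 1 Q 1 "1 + ln Q"] by (intro mult_left_mono) auto
    then show ?thesis using F by (intro mult_right_mono) (auto simp: power2_eq_square mult.assoc)
  qed
  finally show "bellman Q V W x F \<le> (2 + 64 * real CARD('n)) * Q\<^sup>2 * (1 + ln Q) * F"
    by (simp add: algebra_simps)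
qed

text \<open>The jump \<open>e\<close> splits into \<open>y\<close> and D V^{-1} x. The convexity of
  the first form pays for \<open>y\<close>, the gain of the damped form pays for the rest, and
  \<open>F\<close> enters linearly and averages out exactly.\<close>

lemma bellman_midpoint:
  fixes V D W G :: "complex ^ 'n ^ 'n"
  assumes plus: "bellman_domain Q (V + D) (W + G) (x + e) (F + H)"
    and minus: "bellman_domain Q (V - D) (W - G) (x - e) (F - H)"
    and mid: "bellman_domain Q V W x F"
  shows "bellman Q (V + D) (W + G) (x + e) (F + H) + bellman Q (V - D) (W - G) (x - e) (F - H)
    + 2 * ((W *v e) \<bullet> e) \<le> 2 * bellman Q V W x F"
proof -
  note P = plus[unfolded bellman_domain_def] and M = minus[unfolded bellman_domain_def]
    and B = mid[unfolded bellman_domain_def]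
  have V: "pos_def V" "pos_def (V + D)" "pos_def (V - D)"
    and W: "pos_def W" "pos_def (W + G)" "pos_def (W - G)" using P M B by auto
  have Q: "Q \<ge> 1" by (rule bellman_domain_ge_1[OF mid])
  define L where "L = ldet_range TYPE('n) Q"
  have L: "L > 0" unfolding L_def by (rule ldet_range_pos[OF Q])
  define m m1 m2 where "m = ldet_weight Q V W" and "m1 = ldet_weight Q (V + D) (W + G)"
    and "m2 = ldet_weight Q (V - D) (W - G)"
  note mb = ldet_weight_bounds[OF mid, folded m_def] ldet_weight_bounds[OF plus, folded m1_def]
    ldet_weight_bounds[OF minus, folded m2_def]
  define Z Z1 Z2 where "Z = damped_weight Q V W" and "Z1 = damped_weight Q (V + D) (W + G)"
    and "Z2 = damped_weight Q (V - D) (W - G)"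
  note Zb = damped_weight_bounds[OF mid, folded Z_def]
    and Zp = damped_weight_bounds(3)[OF plus, folded Z1_def]
      damped_weight_bounds(3)[OF minus, folded Z2_def]
  have herm: "adjoint_mat D = D" "adjoint_mat G = G"
    using pos_def_adjoint[OF V(1)] pos_def_adjoint[OF V(2)]
      pos_def_adjoint[OF W(1)] pos_def_adjoint[OF W(2)] by (auto simp: adjoint_add)
  obtain \<mu> where mu: "0 \<le> \<mu>"
    "\<And>u. (matrix_inv V *v (D *v u)) \<bullet> (D *v u) \<le> \<mu> * ((V *v u) \<bullet> u)"
    "\<mu> \<le> 2 * ldet V - ldet (V + D) - ldet (V - D)"
    using ldet_strict_concavity[OF V(2,3,1) herm(1)] by metis
  obtain \<nu> where nu: "0 \<le> \<nu>" "\<nu> \<le> 2 * ldet W - ldet (W + G) - ldet (W - G)"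
    using ldet_strict_concavity[OF W(2,3,1) herm(2)] by metis
  \<comment> \<open>The mean of \<open>m1\<close> and \<open>m2\<close> falls below \<open>m\<close>
    by at least this amount: the gap \<mu> of \<open>ldet\<close>, divided by \<open>L\<close> and
    halved by averaging.\<close>
  define d where "d = \<mu> / (2 * L)"
  have d: "d \<ge> 0" using mu L by (simp add: d_def)
  have "m1 + m2 = 2 * m - ((2 * ldet V - ldet (V + D) - ldet (V - D))
      + (2 * ldet W - ldet (W + G) - ldet (W - G))) / L"
    using L by (simp add: m_def m1_def m2_def ldet_weight_def L_def[symmetric] field_simps)
  also have "\<dots> \<le> 2 * m - \<mu> / L"
    using mu nu L by (intro diff_left_mono divide_right_mono) auto
  finally have md: "m1 + m2 \<le> 2 * m - 2 * d" using L by (simp add: d_def)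
  \<comment> \<open>Through V \<le> Q W^{-1}, the gain \<open>d / 2\<close> in the form of W^{-1}
    becomes a gain d/(2 Q) = 2 k in the form of \<open>V\<close>.\<close>
  define k where "k = d / (4 * Q)"
  have k: "k \<ge> 0" using d Q by (simp add: k_def)
  have Zmid: "(Z1 *v u) \<bullet> u + (Z2 *v u) \<bullet> u \<le> 2 * ((Z *v u) \<bullet> u) - 2 * k * ((V *v u) \<bullet> u)" for u
  proof -
    have "2 * inv_form W u / m + d / 2 * inv_form W u
        \<le> inv_form (W + G) u / m1 + inv_form (W - G) u / m2"
      by (rule inv_form_quotient_convex) (use W mb d md in auto)
    moreover have "2 * k * ((V *v u) \<bullet> u) \<le> d / 2 * inv_form W u"
    proof -
      have "2 * k * ((V *v u) \<bullet> u) \<le> 2 * k * (Q * inv_form W u)"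
        using k B by (intro mult_left_mono) auto
      then show ?thesis using Q by (simp add: k_def)
    qed
    ultimately show ?thesis
      unfolding Z_def Z1_def Z2_def damped_weight_form
      by (simp add: m_def m1_def m2_def matrix_vector_mult_add_rdistrib
          matrix_vector_mult_diff_rdistrib inner_add_left inner_diff_left)
  qed
  define y where "y = e - D *v (matrix_inv V *v x)"
  have 1: "2 * inv_form V x + 2 * inv_form V y \<le> inv_form (V + D) (x + e) + inv_form (V - D) (x - e)"
    unfolding y_def by (rule inv_form_midpoint[OF V(2,3,1)])
  have 2: "2 * inv_form Z x + k / 2 * inv_form V x \<le> inv_form Z1 (x + e) + inv_form Z2 (x - e)"
    by (rule inv_form_midpoint_gain[OF Zp Zb(3) V(1) k Zb(2) Zmid])
  have "inv_form V (D *v (matrix_inv V *v x)) \<le> \<mu> * inv_form V x"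
    using mu(2)[of "matrix_inv V *v x"]
    by (simp add: inv_form_def pos_def_invertible[OF V(1)] inner_commute)
  moreover have "inv_form V e \<le> 2 * inv_form V y + 2 * inv_form V (D *v (matrix_inv V *v x))"
    using inv_form_add_le[OF V(1), of y "D *v (matrix_inv V *v x)"] by (simp add: y_def)
  ultimately have "inv_form V e \<le> 2 * inv_form V y + 2 * \<mu> * inv_form V x" by simp
  then have "Q * inv_form V e \<le> Q * (2 * inv_form V y + 2 * \<mu> * inv_form V x)"
    using Q by (intro mult_left_mono) auto
  moreover have "(W *v e) \<bullet> e \<le> Q * inv_form V e"
    by (rule quadratic_form_le_inv_form[OF V(1) W(1)]) (use B Q in auto)
  ultimately have We: "2 * ((W *v e) \<bullet> e) \<le> Q * (4 * inv_form V y + 4 * \<mu> * inv_form V x)"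
    by (simp add: distrib_left)
  define S S' where "S = inv_form (V + D) (x + e) + inv_form (V - D) (x - e) - 2 * inv_form V x"
    and "S' = 64 * Q * L * (inv_form Z1 (x + e) + inv_form Z2 (x - e) - 2 * inv_form Z x)"
  have "4 * \<mu> * inv_form V x = 64 * Q * L * (k / 2 * inv_form V x)"
    using Q L by (simp add: k_def d_def)
  also have "\<dots> \<le> S'"
    unfolding S'_def using 2 Q L by (intro mult_left_mono) auto
  finally have "4 * \<mu> * inv_form V x \<le> S'" .
  moreover have "2 * inv_form V y \<le> S" using 1 by (simp add: S_def)
  ultimately have "4 * inv_form V y + 4 * \<mu> * inv_form V x \<le> 2 * S + S'" by linarith
  then have "Q * (4 * inv_form V y + 4 * \<mu> * inv_form V x) \<le> Q * (2 * S + S')"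
    using Q by (intro mult_left_mono) auto
  moreover have "bellman Q (V + D) (W + G) (x + e) (F + H) + bellman Q (V - D) (W - G) (x - e) (F - H)
      = 2 * bellman Q V W x F - Q * (2 * S + S')"
    unfolding bellman_def Z_def[symmetric] Z1_def[symmetric] Z2_def[symmetric] L_def[symmetric] S_def S'_def
    by (simp add: ring_distribs)
  ultimately show ?thesis using We by linarith
qed

subsection \<open>Averages over intervals\<close>

lemma set_integrable_bounded_linear:
  fixes T :: "'a::{banach,second_countable_topology} \<Rightarrow> 'b::{banach,second_countable_topology}"
  assumes T: "bounded_linear T" and g: "set_integrable M A g"
  shows "set_integrable M A (\<lambda>x. T (g x))"
  using integrable_bounded_linear[OF T g[unfolded set_integrable_def]] T
  by (simp add: set_integrable_def linear_scale bounded_linear.linear)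

lemma set_integral_bounded_linear:
  fixes T :: "'a::{banach,second_countable_topology} \<Rightarrow> 'b::{banach,second_countable_topology}"
  assumes T: "bounded_linear T" and g: "set_integrable M A g"
  shows "(LINT x:A|M. T (g x)) = T (LINT x:A|M. g x)"
  using integral_bounded_linear[OF T g[unfolded set_integrable_def]] T
  by (simp add: set_lebesgue_integral_def linear_scale bounded_linear.linear)

lemma set_integrable_Icc_Ico:
  fixes g :: "real \<Rightarrow> 'a::{banach,second_countable_topology}"
  shows "set_integrable lebesgue {a..b} g \<longleftrightarrow> set_integrable lebesgue {a..<b} g"
  by (rule set_integrable_discrete_difference[where X="{b}"]) auto

lemma set_integral_Icc_Ico:
  fixes g :: "real \<Rightarrow> 'a::{banach,second_countable_topology}"
  shows "(LINT x:{a..b}|lebesgue. g x) = (LINT x:{a..<b}|lebesgue. g x)"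
  by (rule set_integral_discrete_difference[where X="{b}"]) auto

text \<open>Half-open intervals split exactly into their two halves; the omitted endpoint is a null
  set, so the value agrees with \<open>avg\<close>.\<close>

definition mean :: "real \<Rightarrow> real \<Rightarrow> (real \<Rightarrow> 'a::{banach,second_countable_topology}) \<Rightarrow> 'a" where
  "mean a b g = (1 / (b - a)) *\<^sub>R (LINT x:{a..<b}|lebesgue. g x)"

lemma avg_eq_mean: "avg a b X = mean a b X"
  by (simp add: avg_def mean_def set_integral_Icc_Ico)

lemma mean_bounded_linear:
  fixes T :: "'a::{banach,second_countable_topology} \<Rightarrow> 'b::{banach,second_countable_topology}"
  assumes T: "bounded_linear T" and g: "set_integrable lebesgue {a..<b} g"
  shows "mean a b (\<lambda>x. T (g x)) = T (mean a b g)"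
  using T by (simp add: mean_def set_integral_bounded_linear[OF T g] linear_scale bounded_linear.linear)

lemma emeasure_lebesgue_Ico: "a \<le> b \<Longrightarrow> emeasure lebesgue {a..<b} = ennreal (b - a)" for a b :: real
  by simp

lemma set_integrable_Ico_const: "set_integrable lebesgue {a..<b} (\<lambda>x. c :: real)" for a b :: real
  unfolding set_integrable_def
  by (cases "a \<le> b") (auto intro!: integrable_scaleR_left integrable_real_indicator
      simp: emeasure_lebesgue_Ico)

lemma mean_const:
  fixes c :: real
  assumes "a < b"
  shows "mean a b (\<lambda>x. c) = c"
  using assms by (simp add: mean_def set_lebesgue_integral_def measure_def)

lemma mean_mono_AE:
  fixes g h :: "real \<Rightarrow> real"
  assumes "a < b" "set_integrable lebesgue {a..<b} g" "set_integrable lebesgue {a..<b} h"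
    "AE x in lebesgue. g x \<le> h x"
  shows "mean a b g \<le> mean a b h"
proof -
  have "(LINT x:{a..<b}|lebesgue. g x) \<le> (LINT x:{a..<b}|lebesgue. h x)"
    by (rule set_integral_mono_AE[OF assms(2,3)]) (use assms(4) in auto)
  then show ?thesis using assms(1) by (simp add: mean_def divide_right_mono)
qed

lemma mean_halves:
  assumes "a < b" "set_integrable lebesgue {a..<b} g" and c: "c = (a + b) / 2"
  shows "mean a b g = (1/2) *\<^sub>R (mean a c g + mean c b g)"
proof -
  have "a < c" "c < b" using assms by auto
  then have U: "{a..<b} = {a..<c} \<union> {c..<b}" "{a..<c} \<inter> {c..<b} = {}" by auto
  have "set_integrable lebesgue {a..<c} g" "set_integrable lebesgue {c..<b} g"
    by (rule set_integrable_subset[OF assms(2)]; use \<open>a < c\<close> \<open>c < b\<close> in auto)+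
  then have "(LINT x:{a..<b}|lebesgue. g x) = (LINT x:{a..<c}|lebesgue. g x) + (LINT x:{c..<b}|lebesgue. g x)"
    unfolding U(1) by (rule set_integral_Un[OF U(2)])
  moreover have "1 / (c - a) = 2 * (1 / (b - a))" "1 / (b - c) = 2 * (1 / (b - a))"
    using assms(1) by (auto simp: c field_simps)
  ultimately show ?thesis unfolding mean_def by (simp add: scaleR_add_right)
qed

text \<open>Writes the means over the halves as centre plus or minus half the jump, the shape in
  which the midpoint inequality takes them.\<close>

lemma mean_halves_eq:
  assumes "a < b" "set_integrable lebesgue {a..<b} g" and c: "c = (a + b) / 2"
    and d: "d = (1/2) *\<^sub>R (mean c b g - mean a c g)"
  shows "mean c b g = mean a b g + d" "mean a c g = mean a b g - d"
  unfolding mean_halves[OF assms(1-3)] d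
  by (simp_all add: scaleR_add_right scaleR_diff_right flip: scaleR_add_left)

lemma integrable_vecI:
  fixes g :: "'a \<Rightarrow> ('b::euclidean_space) ^ 'n"
  assumes "\<And>i. set_integrable M A (\<lambda>x. g x $ i)"
  shows "set_integrable M A g"
proof -
  have ax: "bounded_linear (axis i :: 'b \<Rightarrow> 'b ^ 'n)" for i
    by (intro linear_conv_bounded_linear[THEN iffD1] linearI)
      (auto simp: vec_eq_iff axis_def)
  have "set_integrable M A (\<lambda>x. \<Sum>i\<in>UNIV. axis i (g x $ i))"
    using set_integrable_bounded_linear[OF ax assms]
    unfolding set_integrable_def scaleR_sum_right by (rule Bochner_Integration.integrable_sum)
  moreover have "(\<lambda>x. \<Sum>i\<in>UNIV. axis i (g x $ i)) = g"
    by (auto simp: vec_eq_iff axis_def if_distrib cong: if_cong)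
  ultimately show ?thesis by simp
qed

lemma loc_integrable_matrix:
  fixes X :: "real \<Rightarrow> complex ^ 'n ^ 'n"
  assumes "loc_integrable_entries X"
  shows "set_integrable lebesgue {a..<b} X"
  using assms unfolding loc_integrable_entries_def set_integrable_Icc_Ico
  by (intro integrable_vecI) auto

lemma bounded_linear_form: "bounded_linear (\<lambda>X :: complex ^ 'n ^ 'n. (X *v u) \<bullet> v)"
  by (intro linear_conv_bounded_linear[THEN iffD1] linearI)
    (auto simp: matrix_vector_mult_add_rdistrib inner_add_left matrix_scaleR_vector)

lemma bounded_linear_adjoint: "bounded_linear (adjoint_mat :: complex ^ 'n ^ 'n \<Rightarrow> _)"
  by (intro linear_conv_bounded_linear[THEN iffD1] linearI)
    (auto simp: adjoint_add adjoint_scaleR)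

lemma mean_form:
  fixes X :: "real \<Rightarrow> complex ^ 'n ^ 'n"
  assumes "set_integrable lebesgue {a..<b} X"
  shows "mean a b (\<lambda>t. (X t *v u) \<bullet> v) = (mean a b X *v u) \<bullet> v"
    "set_integrable lebesgue {a..<b} (\<lambda>t. (X t *v u) \<bullet> v)"
  using mean_bounded_linear[OF bounded_linear_form assms]
    set_integrable_bounded_linear[OF bounded_linear_form assms] by auto

text \<open>Strictness survives averaging: a nonnegative integrand with integral zero vanishes
  almost everywhere, which would make the interval a null set.\<close>

lemma pos_def_mean:
  fixes X :: "real \<Rightarrow> complex ^ 'n ^ 'n"
  assumes ab: "a < b" and X: "set_integrable lebesgue {a..<b} X"
    and pos: "AE t in lebesgue. pos_def (X t)"
  shows "pos_def (mean a b X)"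
proof -
  have "adjoint_mat (mean a b X) = mean a b (\<lambda>t. adjoint_mat (X t))"
    by (rule mean_bounded_linear[OF bounded_linear_adjoint X, symmetric])
  also have "\<dots> = mean a b X"
  proof -
    have [measurable]: "(\<lambda>t. indicator {a..<b} t *\<^sub>R X t) \<in> borel_measurable lebesgue"
      "(\<lambda>t. indicator {a..<b} t *\<^sub>R adjoint_mat (X t)) \<in> borel_measurable lebesgue"
      using X set_integrable_bounded_linear[OF bounded_linear_adjoint X]
      by (auto simp: set_integrable_def)
    have "(LINT t:{a..<b}|lebesgue. adjoint_mat (X t)) = (LINT t:{a..<b}|lebesgue. X t)"
      unfolding set_lebesgue_integral_def
      by (rule integral_cong_AE) (use pos in \<open>auto simp: pos_def_def\<close>)
    then show ?thesis by (simp add: mean_def)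
  qed
  finally have herm: "adjoint_mat (mean a b X) = mean a b X" .
  have "0 < (mean a b X *v v) \<bullet> v" if v: "v \<noteq> 0" for v
  proof -
    define g where "g = (\<lambda>t. indicator {a..<b} t * ((X t *v v) \<bullet> v))"
    have g: "integrable lebesgue g"
      using mean_form(2)[OF X, of v v] by (simp add: g_def set_integrable_def)
    have "AE t in lebesgue. 0 < (X t *v v) \<bullet> v"
      using pos by eventually_elim (use v in \<open>auto intro: pos_defD\<close>)
    then have pos': "AE t in lebesgue. 0 \<le> g t" "AE t in lebesgue. g t = 0 \<longrightarrow> t \<notin> {a..<b}"
      by (eventually_elim; auto simp: g_def indicator_def)+
    have "integral\<^sup>L lebesgue g \<noteq> 0"
    proof
      assume "integral\<^sup>L lebesgue g = 0"
      then have "AE t in lebesgue. g t = 0"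
        using integral_nonneg_eq_0_iff_AE[OF g pos'(1)] by simp
      with pos'(2) have "AE t in lebesgue. t \<notin> {a..<b}" by eventually_elim auto
      then have "emeasure lebesgue {a..<b} = 0"
        by (subst (asm) AE_iff_measurable[where N="{a..<b}"]) auto
      then show False using ab by simp
    qed
    moreover have "integral\<^sup>L lebesgue g \<ge> 0" by (rule integral_nonneg_AE[OF pos'(1)])
    ultimately have "integral\<^sup>L lebesgue g > 0" by simp
    moreover have "(mean a b X *v v) \<bullet> v = (1 / (b - a)) * integral\<^sup>L lebesgue g"
      using mean_form(1)[OF X, of v v] by (simp add: mean_def set_lebesgue_integral_def g_def)
    ultimately show ?thesis using ab by simp
  qed
  with herm show ?thesis by (simp add: pos_def_def)
qed

text \<open>With B the square root of \<open>A\<close>, the form at v is the squared norm of B v. If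
  it vanishes, then A v = B (B v) = 0, against invertibility.\<close>

lemma pos_def_if_invertible:
  fixes A :: "complex ^ 'n ^ 'n"
  assumes A: "pos_semidef A" and inv: "invertible A"
  shows "pos_def A"
proof -
  have "0 < (A *v v) \<bullet> v" if v: "v \<noteq> 0" for v
  proof (rule ccontr)
    let ?B = "mat_sqrt A"
    assume "\<not> ?thesis"
    then have "(A *v v) \<bullet> v = 0" using A by (simp add: pos_semidef_iff order.antisym)
    moreover have "A *v v = ?B *v (?B *v v)" by (simp add: matrix_vector_mul_assoc mat_sqrt[OF A])
    ultimately have "(?B *v v) \<bullet> (?B *v v) = 0"
      using mat_sqrt(1)[OF A] herm_inner[of ?B "?B *v v" v] by (simp add: pos_semidef_iff)
    then have "A *v v = 0" using \<open>A *v v = ?B *v (?B *v v)\<close> by simp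
    then show False using inv v invertible_left_inverse matrix_left_invertible_ker by blast
  qed
  then show ?thesis using A by (auto simp: pos_def_def pos_semidef_iff)
qed

lemma pos_def_pos_semidef: "pos_def A \<Longrightarrow> pos_semidef A"
  using pos_def_nonneg by (auto simp: pos_semidef_iff pos_def_adjoint)

lemma norm_op_norm: "norm (A *v v) \<le> op_norm A * norm v"
  unfolding op_norm_def by (rule onorm) (rule matrix_vector_mul_bounded_linear)

text \<open>Translates the operator norm in the \<open>A_2\<close> quantity into V \<le> Q W^{-1}:
  write u = W^{1/2} z, move the roots across the inner product and apply Cauchy-Schwarz.\<close>

lemma sqrt_product_bound:
  fixes V W :: "complex ^ 'n ^ 'n"
  assumes V: "pos_def V" and W: "pos_def W"
    and Q: "(op_norm (mat_sqrt W ** mat_sqrt V))\<^sup>2 \<le> Q"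
  shows "(V *v u) \<bullet> u \<le> Q * inv_form W u"
proof -
  define R S where "R = mat_sqrt V" and "S = mat_sqrt W"
  note VS = mat_sqrt[OF pos_def_pos_semidef[OF V], folded R_def]
    mat_sqrt[OF pos_def_pos_semidef[OF W], folded S_def]
  have R: "adjoint_mat R = R" "R ** R = V" and S: "adjoint_mat S = S" "S ** S = W"
    using VS by (auto simp: pos_semidef_iff)
  \<comment> \<open>This is W^{-1/2} u, written without an inverse of the root.\<close>
  define z where "z = S *v (matrix_inv W *v u)"
  have Sz: "S *v z = u"
    by (simp add: z_def matrix_vector_mul_assoc matrix_mul_assoc S pos_def_invertible[OF W])
  have "z \<bullet> z = (matrix_inv W *v u) \<bullet> (S *v z)"
    unfolding z_def by (simp add: herm_inner[OF S(1)])
  then have zz: "(norm z)\<^sup>2 = inv_form W u" by (simp add: Sz inv_form_def power2_norm_eq_inner)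
  define y where "y = R *v u"
  have "(V *v u) \<bullet> u = y \<bullet> y"
    using herm_inner[OF R(1), of "R *v u" u] by (simp add: y_def matrix_vector_mul_assoc R)
  then have yy: "(V *v u) \<bullet> u = (norm y)\<^sup>2" by (simp add: power2_norm_eq_inner)
  let ?N = "op_norm (S ** R)"
  have "(norm y)\<^sup>2 = y \<bullet> (R *v (S *v z))" by (simp add: Sz y_def power2_norm_eq_inner)
  also have "\<dots> = ((S ** R) *v y) \<bullet> z"
    by (simp add: herm_inner[OF R(1)] herm_inner[OF S(1)] flip: matrix_vector_mul_assoc)
  also have "\<dots> \<le> norm ((S ** R) *v y) * norm z" by (rule norm_cauchy_schwarz)
  also have "\<dots> \<le> (?N * norm y) * norm z" by (intro mult_right_mono norm_op_norm) auto
  finally have "norm y * norm y \<le> norm y * (?N * norm z)" by (simp add: power2_eq_square mult_ac)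
  then have "norm y \<le> ?N * norm z \<or> y = 0" by auto
  moreover have "0 \<le> ?N" unfolding op_norm_def by (intro onorm_pos_le matrix_vector_mul_bounded_linear)
  ultimately have "norm y \<le> ?N * norm z" by auto
  then have "(norm y)\<^sup>2 \<le> (?N * norm z)\<^sup>2" by (intro power_mono) auto
  also have "\<dots> = ?N\<^sup>2 * inv_form W u" by (simp add: power_mult_distrib zz)
  also have "\<dots> \<le> Q * inv_form W u"
    using Q by (intro mult_right_mono inv_form_nonneg W) (simp add: R_def S_def)
  finally show ?thesis by (simp add: yy)
qed

lemma matrix_inv_matrix_inv:
  fixes A :: "complex ^ 'n ^ 'n"
  shows "pos_def A \<Longrightarrow> matrix_inv (matrix_inv A) = A"
  by (intro matrix_inv_eqI pos_def_invertible)

section \<open>Averages of a fixed weight and function as points of the Bellman domain\<close>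

locale A2_weight =
  fixes W :: "real \<Rightarrow> complex ^ 'n ^ 'n" and f :: "real \<Rightarrow> complex ^ 'n"
  assumes weight: "matrix_weight W" and A2: "matrix_A2 W" and f_L2: "f \<in> L2_weighted W"
begin

definition "energy t = (W t *v f t) \<bullet> f t"

definition "inverse_weight t = matrix_inv (W t)"

lemma AE_pos_def: "AE t in lebesgue. pos_def (W t)"
proof -
  have "AE t in lebesgue. pos_semidef (W t)" "AE t in lebesgue. invertible (W t)"
    using weight A2 by (auto simp: matrix_weight_def matrix_A2_def)
  then show ?thesis by eventually_elim (rule pos_def_if_invertible)
qed

lemma AE_pos_def_inverse: "AE t in lebesgue. pos_def (inverse_weight t)"
  using AE_pos_def by eventually_elim (simp add: inverse_weight_def pos_def_matrix_inv)

lemma integrable_weight: "set_integrable lebesgue {a..<b} W"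
  using weight by (intro loc_integrable_matrix) (simp add: matrix_weight_def)

lemma integrable_inverse_weight: "set_integrable lebesgue {a..<b} inverse_weight"
  using A2 by (intro loc_integrable_matrix) (simp add: matrix_A2_def inverse_weight_def[abs_def])

lemma energy_integrable: "integrable lebesgue energy"
  using f_L2 by (simp add: L2_weighted_def energy_def[abs_def] Re_cip)

lemma set_integrable_energy: "set_integrable lebesgue {a..<b} energy"
  unfolding set_integrable_def by (rule integrable_mult_indicator[OF _ energy_integrable]) simp

lemma normsq_eq: "L2_weighted_normsq W f = integral\<^sup>L lebesgue energy"
  by (simp add: L2_weighted_normsq_def energy_def[abs_def] Re_cip)

text \<open>Pointwise duality for W^{-1}. Being linear in \<open>f\<close> and in W^{-1}, the lower
  bound can be integrated; it yields local integrability of \<open>f\<close> as well as the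
  Cauchy-Schwarz constraint.\<close>

lemma AE_energy_ge: "AE t in lebesgue. 2 * (f t \<bullet> u) - (inverse_weight t *v u) \<bullet> u \<le> energy t"
  using AE_pos_def
proof eventually_elim
  case (elim t)
  have "2 * (f t \<bullet> u) - (inverse_weight t *v u) \<bullet> u \<le> (matrix_inv (inverse_weight t) *v f t) \<bullet> f t"
    unfolding inverse_weight_def by (intro inverse_form_ge pos_def_matrix_inv elim)
  then show ?case by (simp add: inverse_weight_def matrix_inv_matrix_inv elim energy_def)
qed

lemma AE_energy_nonneg: "AE t in lebesgue. 0 \<le> energy t"
  using AE_energy_ge[of 0] by simp

text \<open>Duality at \<open>u\<close> and at \<open>-u\<close> dominates each component of
  \<open>f\<close> by the energy plus a form of the locally integrable W^{-1}.\<close>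

lemma set_integrable_f: "set_integrable lebesgue {a..<b} f"
proof -
  have meas: "f \<in> borel_measurable lebesgue" using f_L2 by (simp add: L2_weighted_def)
  have component: "set_integrable lebesgue {a..<b} (\<lambda>t. f t \<bullet> u)" for u
  proof -
    define g where "g = (\<lambda>t. energy t + (inverse_weight t *v u) \<bullet> u)"
    have g: "set_integrable lebesgue {a..<b} g"
      unfolding g_def by (intro set_integral_add set_integrable_energy mean_form integrable_inverse_weight)
    have "AE t in lebesgue. \<bar>f t \<bullet> u\<bar> \<le> g t"
      using AE_energy_ge[of u] AE_energy_ge[of "-u"] AE_energy_nonneg AE_pos_def_inverse
    proof eventually_elim
      case (elim t)
      then show ?case using pos_def_nonneg[OF elim(4), of u]
        by (auto simp: g_def matrix_vector_mult_diff_distrib[of _ 0 u, simplified])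
    qed
    moreover have "set_borel_measurable lebesgue {a..<b} (\<lambda>t. f t \<bullet> u)"
      unfolding set_borel_measurable_def
      by (intro borel_measurable_scaleR borel_measurable_indicator borel_measurable_inner meas) auto
    ultimately show ?thesis
      by (intro set_integrable_bound[OF g]) auto
  qed
  have "set_integrable lebesgue {a..<b} (\<lambda>t. \<Sum>u\<in>Basis. (f t \<bullet> u) *\<^sub>R u)"
    using set_integrable_bounded_linear[OF bounded_linear_scaleR_left component]
    unfolding set_integrable_def scaleR_sum_right by (rule Bochner_Integration.integrable_sum)
  then show ?thesis by (simp add: euclidean_representation)
qed

text \<open>Both Jensen-type constraints follow by integrating the pointwise duality bound at a
  fixed vector \<open>w\<close>, chosen as the maximizer for the averaged matrix, so that the
  averaged bound is exactly \<open>inv_form\<close>.\<close>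

lemma in_bellman_domain:
  assumes ab: "a < b"
  shows "bellman_domain (A2_const W) (mean a b inverse_weight) (mean a b W) (mean a b f) (mean a b energy)"
proof -
  let ?V = "mean a b inverse_weight" and ?W = "mean a b W"
  have V: "pos_def ?V" by (intro pos_def_mean ab integrable_inverse_weight AE_pos_def_inverse)
  have W: "pos_def ?W" by (intro pos_def_mean ab integrable_weight AE_pos_def)
  have 1: "inv_form ?W u \<le> (?V *v u) \<bullet> u" for u
  proof -
    define w where "w = matrix_inv ?W *v u"
    have int: "set_integrable lebesgue {a..<b} (\<lambda>t. 2 * (u \<bullet> w) - (W t *v w) \<bullet> w)"
      by (intro set_integral_diff set_integrable_Ico_const mean_form integrable_weight)
    have "mean a b (\<lambda>t. 2 * (u \<bullet> w) - (W t *v w) \<bullet> w) \<le> mean a b (\<lambda>t. (inverse_weight t *v u) \<bullet> u)"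
    proof (rule mean_mono_AE[OF ab int mean_form(2)[OF integrable_inverse_weight]])
      show "AE t in lebesgue. 2 * (u \<bullet> w) - (W t *v w) \<bullet> w \<le> (inverse_weight t *v u) \<bullet> u"
        using AE_pos_def by eventually_elim (simp add: inverse_weight_def inverse_form_ge)
    qed
    also have "mean a b (\<lambda>t. 2 * (u \<bullet> w) - (W t *v w) \<bullet> w) = 2 * (u \<bullet> w) - (?W *v w) \<bullet> w"
      using mean_const[OF ab, of "2 * (u \<bullet> w)"] mean_form(1)[OF integrable_weight, of a b w w]
      unfolding mean_def
      by (subst set_integral_diff(2)[OF set_integrable_Ico_const mean_form(2)[OF integrable_weight]])
        (simp add: scaleR_diff_right right_diff_distrib)
    also have "\<dots> = inv_form ?W u"
      by (simp add: w_def inv_form_def pos_def_invertible[OF W] inner_commute)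
    finally show ?thesis by (simp add: mean_form[OF integrable_inverse_weight])
  qed
  have 2: "(?V *v u) \<bullet> u \<le> A2_const W * inv_form ?W u" for u
  proof (rule sqrt_product_bound[OF V W])
    have "A2_quantity W a b \<le> A2_const W"
      unfolding A2_const_def using A2 ab
      by (intro cSUP_upper2[where x="(a, b)"]) (auto simp: matrix_A2_def)
    then show "(op_norm (mat_sqrt ?W ** mat_sqrt ?V))\<^sup>2 \<le> A2_const W"
      by (simp add: A2_quantity_def avg_eq_mean inverse_weight_def[abs_def])
  qed
  have "inv_form ?V (mean a b f) \<le> mean a b energy"
  proof -
    define w where "w = matrix_inv ?V *v mean a b f"
    have bl: "bounded_linear (\<lambda>x. 2 * (x \<bullet> w))"
      by (intro bounded_linear_intros)
    have int: "set_integrable lebesgue {a..<b} (\<lambda>t. 2 * (f t \<bullet> w))"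
      by (rule set_integrable_bounded_linear[OF bl set_integrable_f])
    have int': "set_integrable lebesgue {a..<b} (\<lambda>t. 2 * (f t \<bullet> w) - (inverse_weight t *v w) \<bullet> w)"
      by (intro set_integral_diff int mean_form integrable_inverse_weight)
    have "mean a b (\<lambda>t. 2 * (f t \<bullet> w) - (inverse_weight t *v w) \<bullet> w) \<le> mean a b energy"
      by (rule mean_mono_AE[OF ab int' set_integrable_energy AE_energy_ge])
    also have "mean a b (\<lambda>t. 2 * (f t \<bullet> w) - (inverse_weight t *v w) \<bullet> w)
        = 2 * (mean a b f \<bullet> w) - (?V *v w) \<bullet> w"
      using mean_bounded_linear[OF bl set_integrable_f, of a b]
        mean_form(1)[OF integrable_inverse_weight, of a b w w]
      unfolding mean_def
      by (subst set_integral_diff(2)[OF int mean_form(2)[OF integrable_inverse_weight]])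
        (simp add: scaleR_diff_right right_diff_distrib)
    also have "\<dots> = inv_form ?V (mean a b f)"
      by (simp add: w_def inv_form_def pos_def_invertible[OF V] inner_commute)
    finally show ?thesis .
  qed
  with V W 1 2 show ?thesis by (simp add: bellman_domain_def)
qed

text \<open>The factor \<open>b - a\<close> makes the midpoint inequality additive over the two
  halves.\<close>

definition "potential a b = (b - a) * bellman (A2_const W) (mean a b inverse_weight) (mean a b W)
  (mean a b f) (mean a b energy)"

definition "bellman_factor = (2 + 64 * real CARD('n)) * (A2_const W)\<^sup>2 * (1 + ln (A2_const W))"

lemma bellman_factor_nonneg: "0 \<le> bellman_factor"
  using bellman_domain_ge_1[OF in_bellman_domain[of 0 1]] by (simp add: bellman_factor_def)

lemma potential_bounds:
  assumes ab: "a < b"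
  shows "0 \<le> potential a b" "potential a b \<le> bellman_factor * (LINT t:{a..<b}|lebesgue. energy t)"
proof -
  note B = bellman_bounds[OF in_bellman_domain[OF ab]]
  show "0 \<le> potential a b" using B(1) ab by (simp add: potential_def)
  have "potential a b \<le> (b - a) * (bellman_factor * mean a b energy)"
    unfolding potential_def bellman_factor_def using B(2) ab by (intro mult_left_mono) auto
  also have "\<dots> = bellman_factor * (LINT t:{a..<b}|lebesgue. energy t)"
    using ab by (simp add: mean_def)
  finally show "potential a b \<le> bellman_factor * (LINT t:{a..<b}|lebesgue. energy t)" .
qed

text \<open>The integral over each half is \<open>(b - a) / 2\<close> times its mean, so the Haar
  coefficient is \<open>sqrt (b - a)\<close> times the half jump \<open>e\<close>.\<close>

lemma square_function_term_eq:
  assumes ab: "a < b" and c: "c = (a + b) / 2" and e: "e = (1/2) *\<^sub>R (mean c b f - mean a c f)"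
  shows "square_function_term W f (a, b) = (b - a) * ((mean a b W *v e) \<bullet> e)"
proof -
  have acb: "a < c" "c < b" using ab c by auto
  let ?s = "sqrt (b - a)"
  have s: "?s > 0" "?s\<^sup>2 = b - a" using ab by auto
  have sub: "set_integrable lebesgue {a..<c} f" "set_integrable lebesgue {c..<b} f"
    by (rule set_integrable_f)+
  have "haar_coeff f a b = (LINT t|lebesgue. (1 / ?s) *\<^sub>R (indicator {c..<b} t *\<^sub>R f t - indicator {a..<c} t *\<^sub>R f t))"
    unfolding haar_coeff_def set_lebesgue_integral_def
    by (rule Bochner_Integration.integral_cong)
      (use acb in \<open>auto simp: haar_def c[symmetric] indicator_def\<close>)
  also have "\<dots> = (1 / ?s) *\<^sub>R ((LINT t:{c..<b}|lebesgue. f t) - (LINT t:{a..<c}|lebesgue. f t))"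
    using sub unfolding set_integrable_def set_lebesgue_integral_def by simp
  also have "(LINT t:{c..<b}|lebesgue. f t) = ((b - a) / 2) *\<^sub>R mean c b f"
    using ab by (simp add: mean_def c field_simps)
  also have "(LINT t:{a..<c}|lebesgue. f t) = ((b - a) / 2) *\<^sub>R mean a c f"
    using ab by (simp add: mean_def c field_simps)
  also have "(1 / ?s) *\<^sub>R (((b - a) / 2) *\<^sub>R mean c b f - ((b - a) / 2) *\<^sub>R mean a c f) = ?s *\<^sub>R e"
    using s by (simp add: e scaleR_diff_right real_div_sqrt)
  finally have h: "haar_coeff f a b = ?s *\<^sub>R e" .
  show ?thesis
    unfolding square_function_term_def prod.case Re_cip h avg_eq_mean quadratic_scaleR s(2) ..
qed

lemma square_function_term_nonneg:
  assumes "a < b"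
  shows "0 \<le> square_function_term W f (a, b)"
  unfolding square_function_term_eq[OF assms refl refl]
  using in_bellman_domain[OF assms] assms
  by (intro mult_nonneg_nonneg pos_def_nonneg) (auto simp: bellman_domain_def)

text \<open>The midpoint inequality of the Bellman function, multiplied by the common length
  \<open>(b - a) / 2\<close> of the halves.\<close>

lemma potential_halves:
  assumes ab: "a < b" and c: "c = (a + b) / 2"
  shows "potential a c + potential c b + square_function_term W f (a, b) \<le> potential a b"
proof -
  have acb: "a < c" "c < b" using ab c by auto
  define D G e H where "D = (1/2) *\<^sub>R (mean c b inverse_weight - mean a c inverse_weight)"
    and "G = (1/2) *\<^sub>R (mean c b W - mean a c W)"
    and "e = (1/2) *\<^sub>R (mean c b f - mean a c f)"
    and "H = (1/2) *\<^sub>R (mean c b energy - mean a c energy)"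
  note eqs = mean_halves_eq[OF ab integrable_inverse_weight c D_def]
    mean_halves_eq[OF ab integrable_weight c G_def] mean_halves_eq[OF ab set_integrable_f c e_def]
    mean_halves_eq[OF ab set_integrable_energy c H_def]
  let ?B = "\<lambda>a b. bellman (A2_const W) (mean a b inverse_weight) (mean a b W) (mean a b f) (mean a b energy)"
  have "?B c b + ?B a c + 2 * ((mean a b W *v e) \<bullet> e) \<le> 2 * ?B a b"
    using bellman_midpoint[of "A2_const W" "mean a b inverse_weight" D "mean a b W" G "mean a b f" e
        "mean a b energy" H] in_bellman_domain[OF acb(1)] in_bellman_domain[OF acb(2)]
      in_bellman_domain[OF ab]
    unfolding eqs by simp
  then have "((b - a) / 2) * (?B c b + ?B a c + 2 * ((mean a b W *v e) \<bullet> e)) \<le> ((b - a) / 2) * (2 * ?B a b)"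
    using ab by (intro mult_left_mono) auto
  moreover have ca: "c - a = (b - a) / 2" and bc: "b - c = (b - a) / 2"
    using c by (auto simp: field_simps)
  ultimately show ?thesis
    unfolding potential_def square_function_term_eq[OF ab c e_def] ca bc by (simp add: distrib_left)
qed

end

subsection \<open>Summation over the grid\<close>

text \<open>Splits the indices of one generation by parity: the halves of interval \<open>k\<close>
  carry the numbers \<open>2 * k\<close> and \<open>2 * k + 1\<close> in the next one.\<close>

lemma sum_int_pairs:
  fixes g :: "int \<Rightarrow> real"
  shows "(\<Sum>k\<in>{- int N * 2 ^ Suc i..<int N * 2 ^ Suc i}. g k)
    = (\<Sum>k\<in>{- int N * 2 ^ i..<int N * 2 ^ i}. g (2 * k) + g (2 * k + 1))"
proof -
  define M where "M = int N * 2 ^ i"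
  have U: "{- (2 * M)..<2 * M} = (\<lambda>k. 2 * k) ` {- M..<M} \<union> (\<lambda>k. 2 * k + 1) ` {- M..<M}"
  proof (intro set_eqI iffI)
    fix k assume "k \<in> {- (2 * M)..<2 * M}"
    then have "k div 2 \<in> {- M..<M}" "k = 2 * (k div 2) \<or> k = 2 * (k div 2) + 1" by auto
    then show "k \<in> (\<lambda>k. 2 * k) ` {- M..<M} \<union> (\<lambda>k. 2 * k + 1) ` {- M..<M}" by blast
  qed auto
  have "(\<Sum>k\<in>{- (2 * M)..<2 * M}. g k)
      = (\<Sum>k\<in>(\<lambda>k. 2 * k) ` {- M..<M}. g k) + (\<Sum>k\<in>(\<lambda>k. 2 * k + 1) ` {- M..<M}. g k)"
    unfolding U by (rule sum.union_disjoint) (auto, presburger)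
  also have "\<dots> = (\<Sum>k\<in>{- M..<M}. g (2 * k)) + (\<Sum>k\<in>{- M..<M}. g (2 * k + 1))"
    by (simp add: sum.reindex inj_on_def)
  finally show ?thesis by (simp add: M_def sum.distrib mult_ac)
qed

text \<open>Induction on the generation: the values of \<Psi> on one level pay for the terms of that
  level and for \<Psi> on the next. Starting from \<open>2 * N\<close> adjacent intervals covers
  both sides of \<alpha>.\<close>

lemma dyadic_telescoping:
  fixes \<Psi> t :: "real \<Rightarrow> real \<Rightarrow> real" and \<alpha> len :: real
  assumes step: "\<And>a b c. a < b \<Longrightarrow> c = (a + b) / 2 \<Longrightarrow> \<Psi> a c + \<Psi> c b + t a b \<le> \<Psi> a b"
    and len: "len > 0"
  defines "p \<equiv> \<lambda>i k. \<alpha> + of_int k * (len / 2 ^ i)"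
  shows "(\<Sum>i<n. \<Sum>k\<in>{- int N * 2 ^ i..<int N * 2 ^ i}. t (p i k) (p i (k + 1)))
      + (\<Sum>k\<in>{- int N * 2 ^ n..<int N * 2 ^ n}. \<Psi> (p n k) (p n (k + 1)))
    \<le> (\<Sum>k\<in>{- int N..<int N}. \<Psi> (p 0 k) (p 0 (k + 1)))"
proof (induction n)
  case 0
  show ?case by simp
next
  case (Suc n)
  let ?R = "{- int N * 2 ^ n..<int N * 2 ^ n}"
  \<comment> \<open>Even endpoints of generation \<open>n + 1\<close> are the endpoints of
    generation \<open>n\<close>; odd ones are the midpoints.\<close>
  have p: "p (Suc n) (2 * k) = p n k" "p (Suc n) (2 * k + 2) = p n (k + 1)"
    "p (Suc n) (2 * k + 1) = (p n k + p n (k + 1)) / 2" "p n k < p n (k + 1)" for k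
    using len by (simp_all add: p_def field_simps)
  have "(\<Sum>k\<in>{- int N * 2 ^ Suc n..<int N * 2 ^ Suc n}. \<Psi> (p (Suc n) k) (p (Suc n) (k + 1)))
      + (\<Sum>k\<in>?R. t (p n k) (p n (k + 1)))
      = (\<Sum>k\<in>?R. \<Psi> (p n k) (p (Suc n) (2 * k + 1)) + \<Psi> (p (Suc n) (2 * k + 1)) (p n (k + 1))
          + t (p n k) (p n (k + 1)))"
    unfolding sum_int_pairs by (simp add: sum.distrib p(1,2) add.assoc)
  also have "\<dots> \<le> (\<Sum>k\<in>?R. \<Psi> (p n k) (p n (k + 1)))"
    by (intro sum_mono step p)
  finally show ?case using Suc.IH by simp
qed

text \<open>Finitely many intervals have a largest scale, a smallest scale and bounded positions, so
  they descend from finitely many adjacent intervals of the largest scale.\<close>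

lemma finite_subset_dyadic_grid:
  assumes F: "finite F" "F \<subseteq> dyadic_grid \<alpha> r" and r: "r > 0"
  obtains len n N where "len > 0"
    "F \<subseteq> (\<lambda>(i, k). (\<alpha> + of_int k * (len / 2 ^ i), \<alpha> + of_int (k + 1) * (len / 2 ^ i)))
       ` (SIGMA i:{..<n}. {- int N * 2 ^ i..<int N * 2 ^ i})"
proof -
  let ?I = "\<lambda>(j, k). (\<alpha> + r * (of_int k * 2 powi j), \<alpha> + r * ((of_int k + 1) * 2 powi j))"
  have "dyadic_grid \<alpha> r \<subseteq> range ?I"
    by (auto simp: dyadic_grid_def standard_dyadic_def)
  then obtain P where P: "finite P" "F = ?I ` P"
    using F by (meson finite_subset_image order_trans)
  \<comment> \<open>Inserting 0 gives the maxima and the minimum a value when \<open>P\<close> is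
    empty.\<close>
  define J where "J = Max (insert 0 (fst ` P))"
  define m where "m = Min (insert 0 (fst ` P))"
  define K where "K = Max (insert 0 ((\<lambda>x. \<bar>snd x\<bar>) ` P))"
  define len where "len = r * 2 powi J"
  \<comment> \<open>Generation \<open>i\<close> has scale exponent \<open>J - i\<close>, and
    \<open>i = J - m\<close> must be included, whence one more generation; \<open>K + 1\<close>
    allows for the excluded right end of the index range.\<close>
  have "F \<subseteq> (\<lambda>(i, k). (\<alpha> + of_int k * (len / 2 ^ i), \<alpha> + of_int (k + 1) * (len / 2 ^ i)))
       ` (SIGMA i:{..<nat (J - m) + 1}. {- int (nat (K + 1)) * 2 ^ i..<int (nat (K + 1)) * 2 ^ i})"
  proof
    fix I assume "I \<in> F"
    then obtain j k where jk: "(j, k) \<in> P" "I = ?I (j, k)" using P by auto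
    have "j \<le> J" "m \<le> j" using P(1) jk(1) unfolding J_def m_def
      by (force intro!: Max_ge Min_le)+
    have kK: "\<bar>k\<bar> \<le> K" using P(1) jk(1) unfolding K_def by (force intro!: Max_ge)
    define i where "i = nat (J - j)"
    have i: "i < nat (J - m) + 1" using \<open>m \<le> j\<close> by (auto simp: i_def)
    have "int i = J - j" using \<open>j \<le> J\<close> by (simp add: i_def)
    then have "(2::real) powi J = 2 powi (j + int i)" by simp
    also have "\<dots> = 2 powi j * 2 ^ i"
      by (subst power_int_add) simp_all
    finally have "(2::real) powi J = 2 powi j * 2 ^ i" .
    then have "len / 2 ^ i = r * 2 powi j" by (simp add: len_def field_simps)
    then have I: "I = (\<alpha> + of_int k * (len / 2 ^ i), \<alpha> + of_int (k + 1) * (len / 2 ^ i))"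
      using jk(2) by (simp add: mult_ac)
    define X where "X = (K + 1) * 2 ^ i"
    \<comment> \<open>The index range only widens with \<open>i\<close>, so a bound on
      \<open>k\<close> that suits generation 0 suits them all.\<close>
    have "(K + 1) * 1 \<le> X" unfolding X_def using kK by (intro mult_left_mono) auto
    moreover have "int (nat (K + 1)) * 2 ^ i = X" "- int (nat (K + 1)) * 2 ^ i = - X"
      using kK by (simp_all add: X_def algebra_simps)
    ultimately have "k \<in> {- int (nat (K + 1)) * 2 ^ i..<int (nat (K + 1)) * 2 ^ i}"
      using kK by (simp only: atLeastLessThan_iff) presburger
    with i I show "I \<in> (\<lambda>(i, k). (\<alpha> + of_int k * (len / 2 ^ i), \<alpha> + of_int (k + 1) * (len / 2 ^ i)))
       ` (SIGMA i:{..<nat (J - m) + 1}. {- int (nat (K + 1)) * 2 ^ i..<int (nat (K + 1)) * 2 ^ i})"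
      by (intro image_eqI[of _ _ "(i, k)"]) auto
  qed
  moreover have "len > 0" using r by (simp add: len_def)
  ultimately show ?thesis by (rule that[rotated])
qed

text \<open>Choosing one preimage for each element of \<open>F\<close> makes \<open>g\<close>
  injective; the remaining terms only increase the sum.\<close>

lemma sum_le_of_subset_image:
  fixes t :: "'b \<Rightarrow> real"
  assumes S: "finite S" and F: "F \<subseteq> g ` S" and nn: "\<And>x. x \<in> S \<Longrightarrow> 0 \<le> t (g x)"
  shows "sum t F \<le> (\<Sum>x\<in>S. t (g x))"
proof -
  obtain S' where S': "S' \<subseteq> S" "inj_on g S'" "F = g ` S'"
    using F by (meson subset_image_inj)
  then have "sum t F = (\<Sum>x\<in>S'. t (g x))" by (simp add: sum.reindex)
  also have "\<dots> \<le> (\<Sum>x\<in>S. t (g x))" using S S' nn by (intro sum_mono2) auto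
  finally show ?thesis .
qed

context A2_weight
begin

lemma sum_energy_le:
  assumes len: "len > 0"
  shows "(\<Sum>k\<in>S. LINT t:{\<alpha> + of_int k * len..<\<alpha> + of_int (k + 1) * len}|lebesgue. energy t)
    \<le> L2_weighted_normsq W f"
proof (cases "finite S")
  case True
  let ?J = "\<lambda>k :: int. {\<alpha> + of_int k * len..<\<alpha> + of_int (k + 1) * len}"
  have "disjoint_family_on ?J S"
    unfolding disjoint_family_on_def
  proof (intro ballI impI)
    have disj: "?J k \<inter> ?J l = {}" if "k < l" for k l
    proof -
      have "of_int (k + 1) * len \<le> of_int l * len" using that len by (intro mult_right_mono) auto
      then show ?thesis by auto
    qed
    fix k l :: int assume "k \<noteq> l"
    then show "?J k \<inter> ?J l = {}" using disj[of k l] disj[of l k] by (metis Int_commute neq_iff)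
  qed
  then have "(\<Sum>k\<in>S. LINT t:?J k|lebesgue. energy t) = (LINT t:(\<Union>k\<in>S. ?J k)|lebesgue. energy t)"
    using True by (intro set_integral_finite_Union[symmetric] set_integrable_energy) auto
  also have "\<dots> \<le> integral\<^sup>L lebesgue energy"
    unfolding set_lebesgue_integral_def
  proof (rule integral_mono_AE[OF _ energy_integrable])
    show "integrable lebesgue (\<lambda>t. indicator (\<Union>k\<in>S. ?J k) t *\<^sub>R energy t)"
      by (rule integrable_mult_indicator[OF _ energy_integrable]) (use True in auto)
    show "AE t in lebesgue. indicator (\<Union>k\<in>S. ?J k) t *\<^sub>R energy t \<le> energy t"
      using AE_energy_nonneg by eventually_elim (auto simp: indicator_def)
  qed
  finally show ?thesis by (simp add: normsq_eq)
next
  case False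
  \<comment> \<open>A sum over an infinite set is 0 by default, so nonnegativity of the norm is
    enough.\<close>
  then show ?thesis by (simp add: normsq_eq integral_nonneg_AE AE_energy_nonneg)
qed

text \<open>The potential telescopes from the largest scale downwards, and at the top it is bounded
  by energies over disjoint intervals.\<close>

lemma finite_sum_bound:
  assumes F: "finite F" "F \<subseteq> dyadic_grid \<alpha> r" and r: "r > 0"
  shows "sum (square_function_term W f) F \<le> bellman_factor * L2_weighted_normsq W f"
proof -
  obtain len n N where len: "len > 0" and
    F': "F \<subseteq> (\<lambda>(i, k). (\<alpha> + of_int k * (len / 2 ^ i), \<alpha> + of_int (k + 1) * (len / 2 ^ i)))
       ` (SIGMA i:{..<n}. {- int N * 2 ^ i..<int N * 2 ^ i})"
    by (rule finite_subset_dyadic_grid[OF F r])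
  define p where "p i k = \<alpha> + of_int k * (len / 2 ^ i)" for i :: nat and k :: int
  have p: "p i k < p i (k + 1)" for i k using len by (simp add: p_def field_simps)
  let ?R = "\<lambda>i. {- int N * 2 ^ i..<int N * 2 ^ i}"
  have F'': "F \<subseteq> (\<lambda>(i, k). (p i k, p i (k + 1))) ` (SIGMA i:{..<n}. ?R i)"
    using F' unfolding p_def .
  let ?t = "\<lambda>a b. square_function_term W f (a, b)"
  have "sum (square_function_term W f) F
      \<le> (\<Sum>x\<in>(SIGMA i:{..<n}. ?R i). square_function_term W f (case x of (i, k) \<Rightarrow> (p i k, p i (k + 1))))"
    by (rule sum_le_of_subset_image[OF _ F'']) (use p in \<open>auto simp: square_function_term_nonneg\<close>)
  also have "\<dots> = (\<Sum>i<n. \<Sum>k\<in>?R i. ?t (p i k) (p i (k + 1)))"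
    by (subst sum.Sigma) (auto simp: case_prod_beta)
  \<comment> \<open>The nonnegative potentials of the lowest generation are added to reach the left
    side of the telescoping inequality.\<close>
  also have "\<dots> \<le> (\<Sum>i<n. \<Sum>k\<in>?R i. ?t (p i k) (p i (k + 1)))
      + (\<Sum>k\<in>?R n. potential (p n k) (p n (k + 1)))"
    using potential_bounds(1) p by (simp add: sum_nonneg)
  also have "\<dots> \<le> (\<Sum>k\<in>{- int N..<int N}. potential (p 0 k) (p 0 (k + 1)))"
    unfolding p_def by (rule dyadic_telescoping[OF potential_halves len])
  also have "\<dots> \<le> (\<Sum>k\<in>{- int N..<int N}. bellman_factor * (LINT t:{p 0 k..<p 0 (k + 1)}|lebesgue. energy t))"
    by (intro sum_mono potential_bounds p)
  also have "\<dots> = bellman_factor * (\<Sum>k\<in>{- int N..<int N}. LINT t:{p 0 k..<p 0 (k + 1)}|lebesgue. energy t)"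
    by (simp add: sum_distrib_left)
  also have "\<dots> \<le> bellman_factor * L2_weighted_normsq W f"
    using sum_energy_le[OF len] bellman_factor_nonneg by (intro mult_left_mono) (auto simp: p_def)
  finally show ?thesis .
qed

text \<open>For nonnegative terms, the uniform bound on finite partial sums gives both summability
  and the bound on the whole sum.\<close>

lemma square_function_bound:
  assumes r: "r > 0"
  shows "square_function_term W f summable_on dyadic_grid \<alpha> r"
    "square_function_normsq (dyadic_grid \<alpha> r) W f \<le> bellman_factor * L2_weighted_normsq W f"
proof -
  have "0 \<le> square_function_term W f I" if "I \<in> dyadic_grid \<alpha> r" for I
  proof -
    obtain j k :: int
      where I: "I = (\<alpha> + r * (of_int k * 2 powi j), \<alpha> + r * ((of_int k + 1) * 2 powi j))"
      using \<open>I \<in> dyadic_grid \<alpha> r\<close> by (auto simp: dyadic_grid_def standard_dyadic_def)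
    have "\<alpha> + r * (of_int k * 2 powi j) < \<alpha> + r * ((of_int k + 1) * 2 powi j)"
      using r by (intro add_strict_left_mono mult_strict_left_mono mult_strict_right_mono) auto
    then show ?thesis unfolding I by (rule square_function_term_nonneg)
  qed
  then show 1: "square_function_term W f summable_on dyadic_grid \<alpha> r"
    by (rule nonneg_bdd_above_summable_on)
      (auto intro!: bdd_aboveI2 finite_sum_bound[OF _ _ r])
  show "square_function_normsq (dyadic_grid \<alpha> r) W f \<le> bellman_factor * L2_weighted_normsq W f"
    unfolding square_function_normsq_def
    by (rule infsum_le_finite_sums[OF 1]) (rule finite_sum_bound[OF _ _ r])
qed

end

theorem theorem3p1:
  "\<exists>C :: real. \<forall>(\<alpha> :: real) (r :: real) (W :: real \<Rightarrow> complex ^ 'n ^ 'n) (f :: real \<Rightarrow> complex ^ 'n).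
     r > 0 \<longrightarrow> matrix_weight W \<longrightarrow> matrix_A2 W \<longrightarrow> f \<in> L2_weighted W \<longrightarrow>
       square_function_term W f summable_on dyadic_grid \<alpha> r \<and>
       square_function_normsq (dyadic_grid \<alpha> r) W f
         \<le> C * (A2_const W)\<^sup>2 * (1 + ln (A2_const W)) * L2_weighted_normsq W f"
\<comment> \<open>The constant is the one in the upper bound of the Bellman function; it depends on
  the dimension alone.\<close>
proof (intro exI[of _ "2 + 64 * real CARD('n)"] allI impI)
  fix \<alpha> r :: real and W :: "real \<Rightarrow> complex ^ 'n ^ 'n" and f :: "real \<Rightarrow> complex ^ 'n"
  assume r: "r > 0" and "matrix_weight W" "matrix_A2 W" "f \<in> L2_weighted W"
  then interpret A2_weight W f by unfold_locales
  show "square_function_term W f summable_on dyadic_grid \<alpha> r \<and>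
       square_function_normsq (dyadic_grid \<alpha> r) W f
         \<le> (2 + 64 * real CARD('n)) * (A2_const W)\<^sup>2 * (1 + ln (A2_const W)) * L2_weighted_normsq W f"
    using square_function_bound[OF r] by (simp add: bellman_factor_def)
qed

end
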